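(* There exists an absolute constant $C>0$ such that for all integers $n,t,k\geq 2$, the number of antichains of $[t]^n$ of size at most $\frac{1}{k}\cdot \alpha(t,n)$ is at most $$\exp_2\left(C\cdot\frac{\log k}{k}\cdot \alpha(t,n)\right).$$
   Context: For an integer $t\geq 2$ write $[t]=\{0,1,\dots,t-1\}$. The hypergrid $[t]^n$ is the poset on $[t]^n$ with the coordinate-wise order: $x\preceq y$ iff $x(i)\leq y(i)$ for all $i$. $\alpha(t,n)$ denotes the maximum size of an antichain in $[t]^n$. $\exp_2(x)=2^x$. *)

theory Defs
  imports Complex_Main "HOL-Library.FuncSet"
begin

definition hypergrid :: "nat \<Rightarrow> nat \<Rightarrow> (nat \<Rightarrow> nat) set" where
  "hypergrid t n = {..<n} \<rightarrow>\<^sub>E {..<t}"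

definition grid_le :: "nat \<Rightarrow> (nat \<Rightarrow> nat) \<Rightarrow> (nat \<Rightarrow> nat) \<Rightarrow> bool" where
  "grid_le n x y \<longleftrightarrow> (\<forall>i<n. x i \<le> y i)"

definition grid_antichains :: "nat \<Rightarrow> nat \<Rightarrow> (nat \<Rightarrow> nat) set set" where
  "grid_antichains t n =
     {A. A \<subseteq> hypergrid t n \<and> (\<forall>x\<in>A. \<forall>y\<in>A. x \<noteq> y \<longrightarrow> \<not> grid_le n x y)}"

definition grid_width :: "nat \<Rightarrow> nat \<Rightarrow> nat" where
  "grid_width t n = Max (card ` grid_antichains t n)"

lemma finite_hypergrid: "finite (hypergrid t n)"
  by (simp add: hypergrid_def finite_PiE)

lemma finite_grid_antichains: "finite (grid_antichains t n)"
  by (rule finite_subset[of _ "Pow (hypergrid t n)"])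
     (auto simp: grid_antichains_def finite_hypergrid)

lemma empty_in_grid_antichains: "{} \<in> grid_antichains t n"
  by (simp add: grid_antichains_def)

lemma grid_width_attained: "\<exists>A\<in>grid_antichains t n. card A = grid_width t n"
proof -
  have "grid_width t n \<in> card ` grid_antichains t n"
    unfolding grid_width_def
    using finite_grid_antichains[of t n] empty_in_grid_antichains[of t n] by (intro Max_in) auto
  then show ?thesis by auto
qed

lemma card_le_grid_width: "A \<in> grid_antichains t n \<Longrightarrow> card A \<le> grid_width t n"
  unfolding grid_width_def using finite_grid_antichains by (intro Max_ge) auto

end

theory Submission
  imports Defs "HOL-Analysis.Convex"
begin

text \<open>
  Write \<open>\<alpha>\<close> for the width. The proof rests on superlinear supersaturation: a set of
  \<open>K\<alpha>\<close> points, \<open>K\<close> large, contains a point comparable to \<open>\<Omega>(K\<^bsup>5/4\<^esup>)\<close> others. To see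
  this, partition the grid into few chains in \<open>M \<approx> \<surd>K\<close> essentially disjoint ways, so that a
  comparable pair shares a chain in at most one of them. If \<open>n \<ge> M\<close>, split the coordinates
  into \<open>M\<close> blocks and use a symmetric chain decomposition inside one block, fixing the other
  coordinates; since \<open>\<alpha> = \<Theta>(t\<^bsup>n-1\<^esup>/\<surd>n)\<close>, this needs only \<open>O(\<surd>M \<alpha>)\<close> chains.
  If \<open>n < M\<close>, use parallel staircases of \<open>M\<close> different slopes in the plane of two coordinates.

  Removing a vertex of degree \<open>d\<close> gives \<open>Z(F) \<le> Z(F - x) + \<mu> Z(F - x - N(x))\<close> for the
  generating function \<open>Z(F) = \<Sum> \<mu>\<^bsup>|A|\<^esup>\<close> over the antichains \<open>A\<close> in \<open>F\<close>. With
  \<open>\<mu> = k\<^bsup>-9\<^esup>\<close> and the degrees above this yields \<open>Z = exp (O(\<alpha>/k))\<close>, and the number of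
  antichains of size at most \<open>\<alpha>/k\<close> is at most \<open>\<mu>\<^bsup>-\<alpha>/k\<^esup> Z\<close>.
\<close>

section \<open>Independent sets in graphs of large degree\<close>

definition neighbours :: "('a \<Rightarrow> 'a \<Rightarrow> bool) \<Rightarrow> 'a set \<Rightarrow> 'a \<Rightarrow> 'a set" where
  "neighbours R F x = {y \<in> F. y \<noteq> x \<and> R x y}"

definition indep_sets :: "('a \<Rightarrow> 'a \<Rightarrow> bool) \<Rightarrow> 'a set \<Rightarrow> 'a set set" where
  "indep_sets R F = {A. A \<subseteq> F \<and> (\<forall>x\<in>A. \<forall>y\<in>A. x \<noteq> y \<longrightarrow> \<not> R x y)}"

definition indep_gf :: "('a \<Rightarrow> 'a \<Rightarrow> bool) \<Rightarrow> real \<Rightarrow> 'a set \<Rightarrow> real" where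
  "indep_gf R \<mu> F = (\<Sum>A\<in>indep_sets R F. \<mu> ^ card A)"

lemma finite_indep_sets: "finite F \<Longrightarrow> finite (indep_sets R F)"
  by (rule finite_subset[of _ "Pow F"]) (auto simp: indep_sets_def)

lemma indep_gf_empty: "indep_gf R \<mu> {} = 1"
proof -
  have "indep_sets R {} = {{}}" by (auto simp: indep_sets_def)
  then show ?thesis by (simp add: indep_gf_def)
qed

lemma indep_gf_remove:
  assumes "finite F" "x \<in> F" "0 \<le> \<mu>"
  shows "indep_gf R \<mu> F \<le> indep_gf R \<mu> (F - {x}) + \<mu> * indep_gf R \<mu> (F - {x} - neighbours R F x)"
proof -
  let ?P = "{A \<in> indep_sets R F. x \<notin> A}" and ?Q = "{A \<in> indep_sets R F. x \<in> A}"
  let ?G = "F - {x} - neighbours R F x"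
  have fin: "finite (indep_sets R F)" using assms finite_indep_sets by blast
  have "indep_gf R \<mu> F = (\<Sum>A\<in>?P. \<mu> ^ card A) + (\<Sum>A\<in>?Q. \<mu> ^ card A)"
    unfolding indep_gf_def
    by (subst sum.union_disjoint[symmetric]) (auto simp: fin intro!: sum.cong)
  also have "?P = indep_sets R (F - {x})" by (auto simp: indep_sets_def)
  also have "(\<Sum>A\<in>?Q. \<mu> ^ card A) = (\<Sum>A\<in>(\<lambda>A. A - {x}) ` ?Q. \<mu> * \<mu> ^ card A)"
  proof (subst sum.reindex)
    show "inj_on (\<lambda>A. A - {x}) ?Q" by (auto intro!: inj_onI)
    show "(\<Sum>A\<in>?Q. \<mu> ^ card A) = sum ((\<lambda>A. \<mu> * \<mu> ^ card A) \<circ> (\<lambda>A. A - {x})) ?Q"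
    proof (rule sum.cong[OF refl])
      fix A assume "A \<in> ?Q"
      then have "finite A" "x \<in> A"
        using assms(1) by (auto simp: indep_sets_def intro: finite_subset)
      then have "card A = Suc (card (A - {x}))" by (rule card.remove)
      then show "\<mu> ^ card A = ((\<lambda>A. \<mu> * \<mu> ^ card A) \<circ> (\<lambda>A. A - {x})) A"
        by (simp only: comp_apply power_Suc)
    qed
  qed
  also have "\<dots> \<le> (\<Sum>A\<in>indep_sets R ?G. \<mu> * \<mu> ^ card A)"
    using assms by (intro sum_mono2 finite_indep_sets) (auto simp: indep_sets_def neighbours_def)
  finally show ?thesis by (simp add: indep_gf_def sum_distrib_left)
qed

lemma sum_atLeast1_antimono_ge:
  fixes \<delta> :: "nat \<Rightarrow> real"
  assumes "antimono_on {1..} \<delta>" "a + d \<le> v"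
  shows "(\<Sum>u=1..a. \<delta> u) + real d * \<delta> v \<le> (\<Sum>u=1..a + d. \<delta> u)"
  using assms(2)
proof (induction d)
  case (Suc d)
  have "\<delta> v \<le> \<delta> (Suc (a + d))"
    using monotone_onD[OF assms(1), of "Suc (a + d)" v] Suc.prems by simp
  then show ?case using Suc by (simp add: algebra_simps)
qed simp

text \<open>This replaces a graph container algorithm: the two terms in \<open>indep_gf_remove\<close> correspond to
  rejecting and to selecting a vertex of large degree.\<close>

lemma indep_gf_le_exp_sum:
  fixes \<delta> :: "nat \<Rightarrow> real"
  assumes "finite F" "0 \<le> \<mu>" and \<delta>: "antimono_on {1..} \<delta>"
    and high_degree: "\<And>G. G \<subseteq> F \<Longrightarrow> G \<noteq> {} \<Longrightarrow>
      \<exists>x\<in>G. \<mu> * exp (- (real (card (neighbours R G x)) * \<delta> (card G))) \<le> \<delta> (card G)"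
  shows "indep_gf R \<mu> F \<le> exp (\<Sum>u=1..card F. \<delta> u)"
  using assms(1) high_degree
proof (induction F rule: finite_psubset_induct)
  case (psubset F)
  define h where "h v = (\<Sum>u=1..v. \<delta> u)" for v
  have IH: "indep_gf R \<mu> G \<le> exp (h (card G))" if "G \<subset> F" for G
    unfolding h_def using that psubset.prems by (intro psubset.IH) auto
  show ?case
  proof (cases "F = {}")
    case False
    then obtain x where x: "x \<in> F"
      and deg: "\<mu> * exp (- (real (card (neighbours R F x)) * \<delta> (card F))) \<le> \<delta> (card F)"
      using psubset.prems by blast
    define G where "G = F - {x} - neighbours R F x"
    define d where "d = card (neighbours R F x)"
    have "neighbours R F x \<subseteq> F - {x}" by (auto simp: neighbours_def)
    then have "card G + d = card (F - {x})"
      unfolding G_def d_def using psubset.hyps card_mono[of "F - {x}"]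
      by (subst card_Diff_subset) (auto intro: finite_subset)
    then have card: "card F = Suc (card G + d)"
      using card.remove[OF psubset.hyps(1) x] by simp
    have h: "h (card F) = h (card G + d) + \<delta> (card F)" unfolding h_def card by simp
    have hG: "h (card G) + real d * \<delta> (card F) \<le> h (card G + d)"
      unfolding h_def using \<delta> card by (intro sum_atLeast1_antimono_ge) auto
    have "indep_gf R \<mu> F \<le> indep_gf R \<mu> (F - {x}) + \<mu> * indep_gf R \<mu> G"
      unfolding G_def using psubset.hyps x assms(2) by (rule indep_gf_remove)
    also have "\<dots> \<le> exp (h (card G + d)) + \<mu> * exp (h (card G))"
      using IH[of "F - {x}"] IH[of G] x card assms(2)
      by (intro add_mono mult_left_mono) (auto simp: G_def)
    also have "\<dots> \<le> exp (h (card G + d)) + \<mu> * exp (h (card G + d) - real d * \<delta> (card F))"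
      using hG assms(2) by (intro add_left_mono mult_left_mono) auto
    also have "\<dots> = exp (h (card G + d)) * (1 + \<mu> * exp (- (real d * \<delta> (card F))))"
      by (simp add: exp_diff exp_minus field_simps)
    also have "\<dots> \<le> exp (h (card G + d)) * exp (\<delta> (card F))"
      using deg exp_ge_add_one_self[of "\<delta> (card F)"]
      by (intro mult_left_mono) (auto simp: d_def simp del: exp_ge_add_one_self)
    finally show ?thesis using h unfolding h_def by (simp add: exp_add)
  qed (simp add: indep_gf_empty)
qed

lemma card_small_indep_sets_le_indep_gf:
  assumes "finite F" "0 < \<mu>" "\<mu> \<le> 1"
  shows "real (card {A \<in> indep_sets R F. real (card A) \<le> a}) \<le> \<mu> powr (- a) * indep_gf R \<mu> F"
proof -
  have "real (card {A \<in> indep_sets R F. real (card A) \<le> a}) =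
      (\<Sum>A\<in>{A \<in> indep_sets R F. real (card A) \<le> a}. 1)" by simp
  also have "\<dots> \<le> (\<Sum>A\<in>{A \<in> indep_sets R F. real (card A) \<le> a}. \<mu> powr (- a) * \<mu> ^ card A)"
  proof (rule sum_mono)
    fix A assume "A \<in> {A \<in> indep_sets R F. real (card A) \<le> a}"
    then have "\<mu> powr a \<le> \<mu> powr real (card A)" using assms by (intro powr_mono') auto
    then show "1 \<le> \<mu> powr (- a) * \<mu> ^ card A"
      using assms by (simp add: powr_minus powr_realpow field_simps)
  qed
  also have "\<dots> \<le> (\<Sum>A\<in>indep_sets R F. \<mu> powr (- a) * \<mu> ^ card A)"
    using assms by (intro sum_mono2 finite_indep_sets) auto
  finally show ?thesis by (simp add: indep_gf_def sum_distrib_left)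
qed

section \<open>Independent sets in supersaturated graphs\<close>

lemma inverse_powr_Suc_le_diff:
  fixes p :: real
  assumes "1 \<le> u" "0 < p"
  shows "1 / real (Suc u) powr (1 + p) \<le> (1 / real u powr p - 1 / real (Suc u) powr p) / p"
proof -
  have "\<exists>z. real u < z \<and> z < real (Suc u) \<and> real (Suc u) powr (- p) - real u powr (- p) =
      (real (Suc u) - real u) * (- p * z powr (- p - 1))"
    using assms by (intro MVT2) (auto intro!: derivative_eq_intros)
  then obtain z where z: "real u < z" "z < real (Suc u)"
    and "real (Suc u) powr (- p) - real u powr (- p) = - (p * z powr (- p - 1))" by auto
  moreover have "- p - 1 = - (1 + p)" by simp
  then have "z powr (- p - 1) = 1 / z powr (1 + p)" by (simp only: powr_minus_divide)
  ultimately have "1 / real u powr p - 1 / real (Suc u) powr p = p * (1 / z powr (1 + p))"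
    by (simp add: powr_minus_divide)
  moreover have "1 / real (Suc u) powr (1 + p) \<le> 1 / z powr (1 + p)"
    using z assms by (intro divide_left_mono powr_mono2) auto
  ultimately show ?thesis using assms by simp
qed

lemma sum_inverse_powr_tail_le:
  fixes p :: real
  assumes "1 \<le> v" "0 < p"
  shows "(\<Sum>u=v+1..V. 1 / real u powr (1 + p)) \<le> 1 / (p * real v powr p)"
proof (cases "v \<le> V")
  case True
  then have "(\<Sum>u=v+1..V. 1 / real u powr (1 + p)) \<le> (1 / real v powr p - 1 / real V powr p) / p"
  proof (induction V rule: dec_induct)
    case (step V)
    then show ?case using inverse_powr_Suc_le_diff[of V p] assms by (simp add: diff_divide_distrib)
  qed simp
  also have "\<dots> \<le> (1 / real v powr p) / p" using assms by (intro divide_right_mono) auto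
  finally show ?thesis by (simp add: mult.commute)
qed (use assms in simp)

lemma exp_minus_le_fact_div_power:
  fixes r :: real
  assumes "0 < r"
  shows "exp (- r) \<le> fact k / r ^ k"
proof -
  have "(\<Sum>n\<in>{k}. r ^ n /\<^sub>R fact n) \<le> exp r"
    unfolding exp_def using assms by (intro sum_le_suminf summable_exp_generic) auto
  then show ?thesis using assms by (simp add: exp_minus field_simps)
qed

locale supersaturated_graph =
  fixes R :: "'a \<Rightarrow> 'a \<Rightarrow> bool" and H :: "'a set" and w :: nat and c K\<^sub>0 :: real and s :: nat
  assumes finite_vertices: "finite H"
    and w_pos: "0 < w" and c_pos: "0 < c" and s_pos: "0 < s"
    and high_degree: "\<And>F K. F \<subseteq> H \<Longrightarrow> K\<^sub>0 \<le> K \<Longrightarrow> K * real w \<le> real (card F) \<Longrightarrow>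
      \<exists>x\<in>F. c * K powr (1 + 2 / real s) \<le> real (card (neighbours R F x))"
begin

text \<open>For sets of \<open>K w\<close> points the weight is of order \<open>K\<^bsup>-(1 + 1/s)\<^esup>\<close>. This is summable, and its
  product with the degree is at least \<open>r = K\<^bsup>1/s\<^esup>\<close>, where \<open>exp (-r)\<close> is below every power of \<open>1/K\<close>.\<close>

definition weight_const :: real where
  "weight_const = K\<^sub>0 powr (1 + 1 / real s) + 1 / c + fact (s + 1)"

definition weight :: "nat \<Rightarrow> nat \<Rightarrow> real" where
  "weight k u = min (1 / real k ^ (s + 1)) (weight_const / (real u / real w) powr (1 + 1 / real s))"

lemma weight_const_pos: "0 < weight_const"
  using c_pos fact_gt_zero[of "s + 1", where ?'a = real]
  unfolding weight_const_def by (intro add_nonneg_pos) auto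

lemma
  shows threshold_powr_le_weight_const: "K\<^sub>0 powr (1 + 1 / real s) \<le> weight_const"
    and one_le_c_mult_weight_const: "1 \<le> c * weight_const"
    and fact_le_weight_const: "fact (s + 1) \<le> weight_const"
proof -
  have "1 = c * (1 / c)" using c_pos by simp
  then show "1 \<le> c * weight_const"
    "K\<^sub>0 powr (1 + 1 / real s) \<le> weight_const" "fact (s + 1) \<le> weight_const"
    using c_pos unfolding weight_const_def distrib_left by auto
qed

lemma antimono_weight: "antimono_on {1..} (weight k)"
proof (rule monotone_onI)
  fix u v :: nat assume "u \<in> {1..}" "v \<in> {1..}" "u \<le> v"
  then have "(real u / real w) powr (1 + 1 / real s) \<le> (real v / real w) powr (1 + 1 / real s)"
    using w_pos by (intro powr_mono2) (auto simp: divide_right_mono)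
  then show "weight k v \<le> weight k u"
    unfolding weight_def using weight_const_pos \<open>u \<in> {1..}\<close> \<open>u \<le> v\<close> w_pos
    by (intro min.mono order_refl divide_left_mono) auto
qed

lemma exp_minus_root_le_weight:
  assumes "0 < K"
  shows "exp (- (K powr (1 / real s))) \<le> weight_const / K powr (1 + 1 / real s)"
proof -
  have "(K powr (1 / real s)) ^ (s + 1) = K powr (real (s + 1) * (1 / real s))"
    using assms by (simp add: powr_power mult.commute del: power_Suc)
  also have "real (s + 1) * (1 / real s) = 1 + 1 / real s" using s_pos by (simp add: field_simps)
  finally have "exp (- (K powr (1 / real s))) \<le> fact (s + 1) / K powr (1 + 1 / real s)"
    using exp_minus_le_fact_div_power[of "K powr (1 / real s)" "s + 1"] assms
    by (simp del: fact_Suc)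
  also have "\<dots> \<le> weight_const / K powr (1 + 1 / real s)"
    by (intro divide_right_mono fact_le_weight_const) auto
  finally show ?thesis .
qed

lemma exists_degree_absorbed_by_weight:
  assumes F: "F \<subseteq> H" "F \<noteq> {}" and k: "1 \<le> k"
  shows "\<exists>x\<in>F. 1 / real k ^ (s + 1) * exp (- (real (card (neighbours R F x)) * weight k (card F)))
    \<le> weight k (card F)"
proof (cases "1 / real k ^ (s + 1) \<le> weight k (card F)")
  case True
  have "1 / real k ^ (s + 1) * exp (- (real d * weight k (card F))) \<le> weight k (card F)" for d
    using weight_const_pos
    by (intro order_trans[OF mult_left_le True]) (auto simp: weight_def)
  then show ?thesis using F(2) by blast
next
  case False
  define K where "K = real (card F) / real w"
  have "finite F" using F finite_vertices finite_subset by blast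
  then have K: "0 < K" using F(2) w_pos by (simp add: K_def card_gt_0_iff)
  have \<mu>: "1 / real k ^ (s + 1) \<le> 1" using k by (simp add: one_le_power del: power_Suc)
  have weight: "weight k (card F) = weight_const / K powr (1 + 1 / real s)"
    using False by (simp add: weight_def K_def min_def split: if_splits)
  then have "weight_const / K powr (1 + 1 / real s) < 1" using False \<mu> by linarith
  then have "weight_const < K powr (1 + 1 / real s)" using K by simp
  then have "K\<^sub>0 powr (1 + 1 / real s) < K powr (1 + 1 / real s)"
    using threshold_powr_le_weight_const by linarith
  then have "K\<^sub>0 \<le> K"
    using powr_mono2[of "1 + 1 / real s" K K\<^sub>0] K by fastforce
  moreover have "K * real w \<le> real (card F)" using w_pos by (simp add: K_def)
  ultimately obtain x where x: "x \<in> F"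
    "c * K powr (1 + 2 / real s) \<le> real (card (neighbours R F x))"
    using high_degree F(1) by blast
  have "K powr (1 / real s) \<le> c * weight_const * K powr (1 / real s)"
    using mult_right_mono[OF one_le_c_mult_weight_const] by fastforce
  also have "\<dots> = c * K powr (1 + 2 / real s) * weight k (card F)"
    using K by (simp add: weight field_simps flip: powr_add)
  also have "\<dots> \<le> real (card (neighbours R F x)) * weight k (card F)"
    using x(2) weight weight_const_pos by (intro mult_right_mono) auto
  finally have "1 / real k ^ (s + 1) * exp (- (real (card (neighbours R F x)) * weight k (card F)))
      \<le> 1 * exp (- (K powr (1 / real s)))"
    using \<mu> by (intro mult_mono) auto
  also have "\<dots> \<le> weight k (card F)"
    using exp_minus_root_le_weight[OF K] weight by simp
  finally show ?thesis using x(1) by blast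
qed

lemma sum_weight_le:
  assumes k: "1 \<le> k"
  shows "(\<Sum>u=1..V. weight k u) \<le> (1 + real s * weight_const) * (real w / real k)"
proof -
  define p where "p = 1 / real s"
  define v where "v = w * k ^ s"
  have p: "0 < p" using s_pos by (simp add: p_def)
  have v: "1 \<le> v" using k w_pos by (simp add: v_def)
  have root: "(real k ^ s) powr p = real k"
    using k s_pos by (simp add: p_def powr_powr flip: powr_realpow)
  have "(\<Sum>u=1..V. weight k u) \<le> (\<Sum>u\<in>{1..v} \<union> {v+1..V}. weight k u)"
    using weight_const_pos by (intro sum_mono2) (auto simp: weight_def)
  also have "\<dots> = (\<Sum>u=1..v. weight k u) + (\<Sum>u=v+1..V. weight k u)"
    by (intro sum.union_disjoint) auto
  also have "(\<Sum>u=1..v. weight k u) \<le> (\<Sum>u=1..v. 1 / real k ^ (s + 1))"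
    by (intro sum_mono) (simp add: weight_def)
  also have "\<dots> = real w / real k" using k by (simp add: v_def)
  also have "(\<Sum>u=v+1..V. weight k u)
      \<le> (\<Sum>u=v+1..V. weight_const * real w powr (1 + p) * (1 / real u powr (1 + p)))"
    by (intro sum_mono) (simp add: weight_def p_def powr_divide)
  also have "\<dots> \<le> weight_const * real w powr (1 + p) * (1 / (p * real v powr p))"
    unfolding sum_distrib_left[symmetric] using sum_inverse_powr_tail_le[OF v p] weight_const_pos
    by (intro mult_left_mono) auto
  also have "\<dots> = real s * weight_const * (real w / real k)"
    using w_pos root by (simp add: v_def p_def powr_mult powr_add)
  finally show ?thesis by (simp add: algebra_simps)
qed

definition count_const :: real where
  "count_const = real (s + 1) + 2 * (1 + real s * weight_const)"

lemma count_const_pos: "0 < count_const"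
  using weight_const_pos by (simp add: count_const_def add_pos_nonneg)

lemma card_small_indep_sets_le:
  assumes k: "2 \<le> k"
  shows "real (card {A \<in> indep_sets R H. real (card A) \<le> real w / real k})
    \<le> 2 powr (count_const * (log 2 (real k) / real k) * real w)"
proof -
  define \<mu> where "\<mu> = 1 / real k ^ (s + 1)"
  define B where "B = 1 + real s * weight_const"
  define a where "a = real w / real k"
  have \<mu>: "0 < \<mu>" "\<mu> \<le> 1" using k by (simp_all add: \<mu>_def one_le_power del: power_Suc)
  have "indep_gf R \<mu> H \<le> exp (\<Sum>u=1..card H. weight k u)"
    using exists_degree_absorbed_by_weight[of _ k] k finite_vertices antimono_weight \<mu>
    by (intro indep_gf_le_exp_sum) (auto simp: \<mu>_def)
  also have "\<dots> \<le> exp (B * a)" using sum_weight_le[of k] k by (simp add: B_def a_def)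
  also have "\<dots> \<le> exp (B * a * (log 2 (real k) * (2 * ln 2)))"
  proof -
    have "1 \<le> log 2 (real k)" using k by simp
    moreover have "1 \<le> 2 * ln (2::real)" using exp_half_le2 ln_ge_iff[of 2 "1 / 2"] by linarith
    ultimately have "1 * 1 \<le> log 2 (real k) * (2 * ln 2)" by (intro mult_mono) auto
    moreover have "0 \<le> B * a" using weight_const_pos by (simp add: a_def B_def)
    ultimately show ?thesis using mult_left_mono by fastforce
  qed
  also have "\<dots> = 2 powr (2 * B * log 2 (real k) * a)" by (simp add: powr_def mult_ac)
  finally have gf: "indep_gf R \<mu> H \<le> 2 powr (2 * B * log 2 (real k) * a)" .
  have "real (card {A \<in> indep_sets R H. real (card A) \<le> a}) \<le> \<mu> powr (- a) * indep_gf R \<mu> H"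
    using finite_vertices \<mu> by (rule card_small_indep_sets_le_indep_gf)
  also have "\<mu> powr (- a) = 2 powr (real (s + 1) * log 2 (real k) * a)"
    using k ln_realpow[of "real k" "s + 1"]
    by (simp add: powr_def \<mu>_def ln_div log_def del: power_Suc)
  also have "2 powr (real (s + 1) * log 2 (real k) * a) * indep_gf R \<mu> H
      \<le> 2 powr (real (s + 1) * log 2 (real k) * a) * 2 powr (2 * B * log 2 (real k) * a)"
    using gf by (intro mult_left_mono) auto
  also have "\<dots> = 2 powr (count_const * (log 2 (real k) / real k) * real w)"
    by (simp add: count_const_def B_def a_def algebra_simps add_divide_distrib flip: powr_add)
  finally show ?thesis unfolding a_def .
qed

end

section \<open>Large degrees from colourings\<close>

lemma card_squared_le_card_image_mult_sum_card_fibre: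
  assumes "finite F"
  shows "(real (card F))\<^sup>2 \<le> real (card (f ` F)) * (\<Sum>x\<in>F. real (card {y \<in> F. f y = f x}))"
proof -
  define c where "c k = real (card {y \<in> F. f y = k})" for k
  have "real (card F) = (\<Sum>k\<in>f ` F. c k)"
    unfolding c_def using sum.image_gen[OF assms, of "\<lambda>_. 1::real" f] by simp
  then have "(real (card F))\<^sup>2 \<le> real (card (f ` F)) * (\<Sum>k\<in>f ` F. (c k)\<^sup>2)"
    using sum_squared_le_sum_of_squares[of c "f ` F"] by (simp add: mult.commute)
  also have "(\<Sum>k\<in>f ` F. (c k)\<^sup>2) = (\<Sum>k\<in>f ` F. \<Sum>x\<in>{x \<in> F. f x = k}. c (f x))"
    by (intro sum.cong) (auto simp: c_def power2_eq_square)
  also have "\<dots> = (\<Sum>x\<in>F. c (f x))" by (rule sum.image_gen[OF assms, symmetric])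
  finally show ?thesis unfolding c_def .
qed

lemma exists_ge_average:
  fixes f :: "'a \<Rightarrow> real"
  assumes "finite F" "F \<noteq> {}" "real (card F) * a \<le> sum f F"
  shows "\<exists>x\<in>F. a \<le> f x"
  using sum_bounded_above_strict[of F f a] assms by (fastforce simp: card_gt_0_iff not_le)

lemma sum_card_far_fibre_ge:
  fixes X q :: real
  assumes F: "finite F" and X: "0 < X" "real (card (f ` F)) \<le> X"
    and few_near: "\<And>x. x \<in> F \<Longrightarrow> real (card {y \<in> F. f y = f x \<and> \<not> far x y}) \<le> q"
  shows "real (card F) * (real (card F) / X - q)
    \<le> (\<Sum>x\<in>F. real (card {y \<in> F. f y = f x \<and> far x y}))"
proof -
  let ?far = "\<lambda>x. {y \<in> F. f y = f x \<and> far x y}"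
  have "(real (card F))\<^sup>2 \<le> X * (\<Sum>x\<in>F. real (card {y \<in> F. f y = f x}))"
    using card_squared_le_card_image_mult_sum_card_fibre[OF F, of f] X(2)
    by (rule order_trans[OF _ mult_right_mono]) (simp add: sum_nonneg)
  also have "\<dots> \<le> X * (\<Sum>x\<in>F. real (card (?far x)) + q)"
  proof (intro mult_left_mono sum_mono)
    fix x assume x: "x \<in> F"
    have "{y \<in> F. f y = f x} = ?far x \<union> {y \<in> F. f y = f x \<and> \<not> far x y}" by auto
    then have "card {y \<in> F. f y = f x} \<le> card (?far x) + card {y \<in> F. f y = f x \<and> \<not> far x y}"
      by (simp add: card_Un_le)
    then show "real (card {y \<in> F. f y = f x}) \<le> real (card (?far x)) + q"
      using few_near[OF x] by linarith
  qed (use X in simp)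
  finally show ?thesis using X by (simp add: sum.distrib field_simps power2_eq_square)
qed

text \<open>Far pairs are monochromatic in at most one of the \<open>M\<close> colourings, so the colourings contribute
  disjoint sets of neighbours.\<close>

lemma exists_high_degree_of_colourings:
  fixes col :: "nat \<Rightarrow> 'a \<Rightarrow> 'b" and X q :: real
  assumes F: "finite F" "F \<noteq> {}" and X: "0 < X"
    and few_colours: "\<And>b. b < M \<Longrightarrow> real (card (col b ` F)) \<le> X"
    and few_near: "\<And>b x. b < M \<Longrightarrow> x \<in> F \<Longrightarrow>
      real (card {y \<in> F. col b y = col b x \<and> \<not> far x y}) \<le> q"
    and neighbour: "\<And>b x y. b < M \<Longrightarrow> x \<in> F \<Longrightarrow> y \<in> F \<Longrightarrow> far x y \<Longrightarrow> col b y = col b x \<Longrightarrow>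
      y \<in> neighbours R F x"
    and once: "\<And>b c x y. b < M \<Longrightarrow> c < M \<Longrightarrow> x \<in> F \<Longrightarrow> y \<in> F \<Longrightarrow> far x y \<Longrightarrow>
      col b y = col b x \<Longrightarrow> col c y = col c x \<Longrightarrow> b = c"
  shows "\<exists>x\<in>F. real M * (real (card F) / X - q) \<le> real (card (neighbours R F x))"
proof (rule exists_ge_average[OF F])
  define P where "P b x = {y \<in> F. col b y = col b x \<and> far x y}" for b x
  have disjoint_pairs_le: "(\<Sum>b<M. real (card (P b x))) \<le> real (card (neighbours R F x))"
    if x: "x \<in> F" for x
  proof -
    have "(\<Sum>b<M. card (P b x)) = card (\<Union>b<M. P b x)"
      using F once x by (intro card_UN_disjoint[symmetric]) (auto simp: P_def)
    also have "\<dots> \<le> card (neighbours R F x)"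
      using F neighbour x by (intro card_mono) (auto simp: P_def neighbours_def)
    finally show ?thesis by (simp flip: of_nat_sum)
  qed
  have "real (card F) * (real M * (real (card F) / X - q))
      = (\<Sum>b<M. real (card F) * (real (card F) / X - q))"
    by (simp add: mult_ac)
  also have "\<dots> \<le> (\<Sum>b<M. \<Sum>x\<in>F. real (card (P b x)))"
    unfolding P_def using F X few_colours few_near by (intro sum_mono sum_card_far_fibre_ge) auto
  also have "\<dots> = (\<Sum>x\<in>F. \<Sum>b<M. real (card (P b x)))" by (rule sum.swap)
  also have "\<dots> \<le> (\<Sum>x\<in>F. real (card (neighbours R F x)))" by (intro sum_mono disjoint_pairs_le)
  finally show "real (card F) * (real M * (real (card F) / X - q))
      \<le> (\<Sum>x\<in>F. real (card (neighbours R F x)))" .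
qed

section \<open>Binomial coefficients\<close>

lemma Suc_times_central_binomial_Suc:
  "Suc j * (2 * Suc j choose Suc j) = 2 * (2 * j + 1) * ((2 * j) choose j)"
proof -
  have "Suc j * (2 * Suc j choose Suc j) = 2 * (Suc j * (Suc (2 * j) choose j))"
    using Suc_times_binomial_eq[of "Suc (2 * j)" j] by (simp add: mult.commute)
  also have "Suc (2 * j) choose j = Suc (2 * j) choose Suc j"
    using binomial_symmetric[of j "Suc (2 * j)"] by (simp add: Suc_diff_le)
  also have "Suc j * (Suc (2 * j) choose Suc j) = (2 * j + 1) * ((2 * j) choose j)"
    using Suc_times_binomial_eq[of "2 * j" j] by (simp add: mult.commute)
  finally show ?thesis by simp
qed

lemma central_binomial_squared_le: "(2 * j + 1) * ((2 * j) choose j)\<^sup>2 \<le> 16 ^ j"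
proof (induction j)
  case (Suc j)
  have "(Suc j)\<^sup>2 * ((2 * Suc j + 1) * (2 * Suc j choose Suc j)\<^sup>2)
      = (2 * j + 3) * (2 * (2 * j + 1) * ((2 * j) choose j))\<^sup>2"
    unfolding Suc_times_central_binomial_Suc[symmetric]
    by (simp add: power_mult_distrib mult.left_commute del: binomial_Suc_Suc mult_Suc)
  also have "\<dots> = 4 * ((2 * j + 3) * (2 * j + 1)) * ((2 * j + 1) * ((2 * j) choose j)\<^sup>2)"
    by (simp add: power2_eq_square algebra_simps)
  also have "\<dots> \<le> 4 * (4 * (Suc j)\<^sup>2) * 16 ^ j"
  proof (rule mult_mono[OF _ Suc])
    show "4 * ((2 * j + 3) * (2 * j + 1)) \<le> 4 * (4 * (Suc j)\<^sup>2)"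
      by (simp add: power2_eq_square algebra_simps)
  qed auto
  finally have "(Suc j)\<^sup>2 * ((2 * Suc j + 1) * (2 * Suc j choose Suc j)\<^sup>2) \<le> (Suc j)\<^sup>2 * 16 ^ Suc j"
    by (simp add: mult_ac)
  then show ?case by (simp only: mult_le_cancel1) simp
qed simp

lemma binomial_squared_le: "(m + 1) * (m choose k)\<^sup>2 \<le> 4 ^ m"
proof -
  have "(m + 1) * (m choose (m div 2))\<^sup>2 \<le> 4 ^ m"
  proof (cases "even m")
    case True
    then obtain j where "m = 2 * j" by auto
    then show ?thesis using central_binomial_squared_le[of j] by (simp add: power_mult)
  next
    case False
    then obtain j where j: "m = 2 * j + 1" by (auto elim: oddE)
    have "4 * ((m + 1) * (m choose (m div 2))\<^sup>2) = (m + 1) * (2 * (m choose (m div 2)))\<^sup>2"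
      by (simp add: power_mult_distrib)
    also have "2 * (m choose (m div 2)) = (2 * Suc j choose Suc j)"
      using binomial_symmetric[of j "Suc (2 * j)"] by (simp add: j Suc_diff_le)
    also have "(m + 1) * (2 * Suc j choose Suc j)\<^sup>2 \<le> (2 * Suc j + 1) * (2 * Suc j choose Suc j)\<^sup>2"
      by (intro mult_right_mono) (auto simp: j)
    also have "\<dots> \<le> 16 ^ Suc j" by (rule central_binomial_squared_le)
    also have "\<dots> = 4 * 4 ^ m" by (simp add: j power_mult)
    finally show ?thesis by simp
  qed
  then show ?thesis
    using binomial_maximum[of m k] by (meson le_trans mult_le_mono2 power_mono zero_le)
qed

lemma binomial_le_div_sqrt: "real (m choose k) \<le> 2 ^ m / sqrt (real (m + 1))"
proof -
  have "(sqrt (real (m + 1)) * real (m choose k))\<^sup>2 = real ((m + 1) * (m choose k)\<^sup>2)"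
    by (simp add: power_mult_distrib distrib_right)
  also have "\<dots> \<le> real (4 ^ m)" unfolding of_nat_le_iff by (rule binomial_squared_le)
  also have "\<dots> = (2 ^ m)\<^sup>2" by (simp add: power2_eq_square flip: power_mult_distrib)
  finally have "(sqrt (real (m + 1)) * real (m choose k))\<^sup>2 \<le> (2 ^ m)\<^sup>2" .
  then have "sqrt (real (m + 1)) * real (m choose k) \<le> 2 ^ m"
    by (rule power2_le_imp_le) simp
  then show ?thesis by (simp add: field_simps)
qed

lemma sum_binomial_div_Suc:
  fixes z :: real
  assumes "z \<noteq> 0"
  shows "(\<Sum>m\<le>N. real (N choose m) * z ^ m / real (m + 1))
      = ((1 + z) ^ Suc N - 1) / (z * real (N + 1))"
proof -
  have absorb: "real (N choose m) * z ^ m / real (m + 1)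
      = real (Suc N choose Suc m) * z ^ Suc m / (z * real (N + 1))" for m
  proof -
    have "real (Suc m) * real (Suc N choose Suc m) = real (Suc N) * real (N choose m)"
      using Suc_times_binomial[of m N] by (metis of_nat_mult)
    then have "real (N choose m) / real (m + 1) = real (Suc N choose Suc m) / real (N + 1)"
      by (simp add: frac_eq_eq mult.commute del: binomial_Suc_Suc)
    then have "real (N choose m) / real (m + 1) * z ^ m
        = real (Suc N choose Suc m) / real (N + 1) * z ^ m"
      by (simp only:)
    then show ?thesis using assms by (simp del: binomial_Suc_Suc)
  qed
  have "(1 + z) ^ Suc N = (\<Sum>m\<le>Suc N. real (Suc N choose m) * z ^ m)"
    using binomial_ring[of z 1 "Suc N"] by (simp add: add.commute del: binomial_Suc_Suc)
  also have "\<dots> = 1 + (\<Sum>m\<le>N. real (Suc N choose Suc m) * z ^ Suc m)"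
    by (simp add: sum.atMost_Suc_shift[of _ N] del: sum.atMost_Suc binomial_Suc_Suc)
  finally show ?thesis unfolding absorb by (simp add: sum_divide_distrib del: binomial_Suc_Suc)
qed

lemma sum_binomial_div_sqrt_le:
  fixes z :: real
  assumes z: "0 < z"
  shows "(\<Sum>m\<le>N. real (N choose m) * z ^ m / sqrt (real (m + 1)))
    \<le> (1 + z) ^ N * sqrt ((1 + z) / z) / sqrt (real (N + 1))"
proof -
  define w where "w m = real (N choose m) * z ^ m" for m
  have w: "w m \<ge> 0" for m using z by (simp add: w_def)
  have "(\<Sum>m\<le>N. w m / sqrt (real (m + 1)))\<^sup>2 = (\<Sum>m\<le>N. sqrt (w m) * sqrt (w m / real (m + 1)))\<^sup>2"
    using w by (intro arg_cong[where f = "\<lambda>x. x\<^sup>2"] sum.cong) (auto simp: real_sqrt_divide)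
  also have "\<dots> \<le> (\<Sum>m\<le>N. (sqrt (w m))\<^sup>2) * (\<Sum>m\<le>N. (sqrt (w m / real (m + 1)))\<^sup>2)"
    by (rule Cauchy_Schwarz_ineq_sum)
  also have "\<dots> = (\<Sum>m\<le>N. w m) * (\<Sum>m\<le>N. w m / real (m + 1))"
    using w by simp
  also have "\<dots> \<le> (1 + z) ^ N * ((1 + z) ^ Suc N / (z * real (N + 1)))"
  proof (rule mult_mono)
    show "(\<Sum>m\<le>N. w m) \<le> (1 + z) ^ N"
      using binomial_ring[of z 1 N] by (simp add: w_def add.commute)
    show "(\<Sum>m\<le>N. w m / real (m + 1)) \<le> (1 + z) ^ Suc N / (z * real (N + 1))"
      unfolding w_def using z by (subst sum_binomial_div_Suc) (auto intro: divide_right_mono)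
  qed (use w z in \<open>auto intro: sum_nonneg\<close>)
  also have "\<dots> = ((1 + z) ^ N * sqrt ((1 + z) / z) / sqrt (real (N + 1)))\<^sup>2"
    using z by (simp add: power_divide power_mult_distrib power2_eq_square mult_ac)
  finally show ?thesis
    unfolding w_def by (rule power2_le_imp_le) (use z in simp)
qed

lemma sum_Pow_card:
  fixes f :: "nat \<Rightarrow> 'b::semiring_1"
  assumes "finite S"
  shows "(\<Sum>I\<in>Pow S. f (card I)) = (\<Sum>m\<le>card S. of_nat (card S choose m) * f m)"
proof -
  have "(\<Sum>I\<in>Pow S. f (card I)) = (\<Sum>m\<le>card S. \<Sum>I\<in>{I \<in> Pow S. card I = m}. f (card I))"
    using assms by (intro sum.group[symmetric]) (auto intro: card_mono)
  also have "\<dots> = (\<Sum>m\<le>card S. \<Sum>I\<in>{I \<in> Pow S. card I = m}. f m)"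
    by (intro sum.cong) auto
  also have "\<dots> = (\<Sum>m\<le>card S. of_nat (card S choose m) * f m)"
    using n_subsets[OF assms] by (simp add: Pow_def)
  finally show ?thesis .
qed

section \<open>The size of a layer\<close>

definition layer :: "'a set \<Rightarrow> nat \<Rightarrow> nat \<Rightarrow> ('a \<Rightarrow> nat) set" where
  "layer I t s = {x \<in> I \<rightarrow>\<^sub>E {..<t}. sum x I = s}"

lemma finite_layer: "finite I \<Longrightarrow> finite (layer I t s)"
  by (simp add: layer_def finite_PiE)

lemma card_PiE_sum_mod_le:
  fixes u :: nat
  assumes "finite I"
  shows "card {U \<in> I \<rightarrow>\<^sub>E {..<u}. sum U I mod u = r} \<le> u ^ (card I - 1)"
proof (cases "I = {}")
  case True
  have "{U \<in> {} \<rightarrow>\<^sub>E {..<u}. sum U {} mod u = r} \<subseteq> {\<lambda>_. undefined}" by auto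
  from card_mono[OF _ this] show ?thesis using True by simp
next
  case False
  then obtain a where a: "a \<in> I" by auto
  let ?S = "{U \<in> I \<rightarrow>\<^sub>E {..<u}. sum U I mod u = r}"
  have "inj_on (\<lambda>U. restrict U (I - {a})) ?S"
  proof (rule inj_onI)
    fix U V assume U: "U \<in> ?S" and V: "V \<in> ?S" and eq: "restrict U (I - {a}) = restrict V (I - {a})"
    have off: "U i = V i" if "i \<in> I - {a}" for i
      using fun_cong[OF eq, of i] that by simp
    have "sum U (I - {a}) = sum V (I - {a})" using off by (intro sum.cong) auto
    moreover have "(U a + sum U (I - {a})) mod u = (V a + sum V (I - {a})) mod u"
      using U V sum.remove[OF assms a, of U] sum.remove[OF assms a, of V] by simp
    ultimately have "U a mod u = V a mod u" by (auto simp: nat_mod_eq_iff)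
    then have "U a = V a" using U V a by (auto simp: PiE_iff)
    then show "U = V" using off U V by (auto intro!: PiE_ext[of U I "\<lambda>_. {..<u}" V])
  qed
  moreover have "(\<lambda>U. restrict U (I - {a})) ` ?S \<subseteq> (I - {a}) \<rightarrow>\<^sub>E {..<u}"
    by (auto simp: PiE_iff split: if_splits)
  ultimately have "card ?S \<le> card ((I - {a}) \<rightarrow>\<^sub>E {..<u})"
    using assms by (intro card_inj_on_le[of "\<lambda>U. restrict U (I - {a})"]) (auto intro: finite_PiE)
  also have "\<dots> = u ^ (card I - 1)" using assms a by (simp add: card_PiE)
  finally show ?thesis .
qed

lemma less_double_eq_mod_add:
  fixes u v :: nat
  assumes "v < 2 * u"
  shows "v = v mod u + u * of_bool (u \<le> v)"
  using assms by (cases "u \<le> v") (auto simp: le_mod_geq)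

lemma card_layer_residues_le:
  assumes I: "finite I" and u: "0 < u"
  shows "card {x \<in> layer I (2 * u) s. \<forall>i\<in>I. x i mod u = U i} \<le> card I choose ((s - sum U I) div u)"
proof -
  let ?Y = "{x \<in> layer I (2 * u) s. \<forall>i\<in>I. x i mod u = U i}"
  define high where "high x = {i \<in> I. u \<le> x i}" for x :: "'a \<Rightarrow> nat"
  have digits: "x i = U i + u * of_bool (i \<in> high x)" if "x \<in> ?Y" "i \<in> I" for x i
  proof -
    have "x i = x i mod u + u * of_bool (u \<le> x i)"
      using that by (intro less_double_eq_mod_add) (auto simp: layer_def PiE_iff)
    also have "\<dots> = U i + u * of_bool (i \<in> high x)" using that by (simp add: high_def)
    finally show ?thesis .
  qed
  have "inj_on high ?Y"
  proof (rule inj_onI)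
    fix x y assume x: "x \<in> ?Y" and y: "y \<in> ?Y" and eq: "high x = high y"
    have "x i = y i" if "i \<in> I" for i using digits[OF x that] digits[OF y that] eq by simp
    then show "x = y" using x y by (auto simp: layer_def intro!: PiE_ext[of x I "\<lambda>_. {..<2 * u}" y])
  qed
  moreover have "high ` ?Y \<subseteq> {B. B \<subseteq> I \<and> card B = (s - sum U I) div u}"
  proof (clarify, intro conjI)
    fix x assume x: "x \<in> layer I (2 * u) s" "\<forall>i\<in>I. x i mod u = U i"
    show "high x \<subseteq> I" by (auto simp: high_def)
    have "s = sum x I" using x by (simp add: layer_def)
    also have "\<dots> = (\<Sum>i\<in>I. U i + u * of_bool (i \<in> high x))"
      using x by (intro sum.cong digits) auto
    also have "\<dots> = sum U I + u * card (high x)"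
      using I by (simp add: sum.distrib high_def Int_def flip: sum_distrib_left)
    finally show "card (high x) = (s - sum U I) div u" using u by simp
  qed
  ultimately have "card ?Y \<le> card {B. B \<subseteq> I \<and> card B = (s - sum U I) div u}"
    using I by (intro card_inj_on_le) auto
  then show ?thesis using I by (simp add: n_subsets)
qed

text \<open>Write \<open>x = U + uB\<close> with \<open>0 \<le> U < u\<close> and \<open>B \<in> {0,1}\<close>. The rank determines \<open>\<Sum> U\<close> modulo \<open>u\<close>,
  which saves a factor \<open>u\<close>, and then the size of \<open>B\<close>, which saves a square root.\<close>

lemma card_layer_even_le:
  assumes I: "finite I" and u: "0 < u"
  shows "real (card (layer I (2 * u) s))
      \<le> real u ^ (card I - 1) * (2 ^ card I / sqrt (real (card I + 1)))"
proof -
  let ?U = "{U \<in> I \<rightarrow>\<^sub>E {..<u}. sum U I mod u = s mod u}"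
  let ?Y = "\<lambda>U. {x \<in> layer I (2 * u) s. \<forall>i\<in>I. x i mod u = U i}"
  have "layer I (2 * u) s \<subseteq> (\<Union>U\<in>?U. ?Y U)"
  proof
    fix x assume x: "x \<in> layer I (2 * u) s"
    then have "restrict (\<lambda>i. x i mod u) I \<in> ?U"
      using u by (simp add: layer_def restrict_PiE_iff mod_sum_eq)
    then show "x \<in> (\<Union>U\<in>?U. ?Y U)" by (rule UN_I) (simp add: x)
  qed
  moreover have fin: "finite ?U" using I by (simp add: finite_PiE)
  ultimately have "card (layer I (2 * u) s) \<le> card (\<Union>U\<in>?U. ?Y U)"
    using finite_layer[OF I] by (intro card_mono) auto
  also have "\<dots> \<le> (\<Sum>U\<in>?U. card (?Y U))" by (rule card_UN_le[OF fin])
  also have "\<dots> \<le> (\<Sum>U\<in>?U. card I choose ((s - sum U I) div u))"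
    using card_layer_residues_le[OF I u] by (intro sum_mono)
  finally have "real (card (layer I (2 * u) s))
      \<le> (\<Sum>U\<in>?U. real (card I choose ((s - sum U I) div u)))"
    by (simp flip: of_nat_sum)
  also have "\<dots> \<le> (\<Sum>U\<in>?U. 2 ^ card I / sqrt (real (card I + 1)))"
    by (intro sum_mono binomial_le_div_sqrt)
  also have "\<dots> = real (card ?U) * (2 ^ card I / sqrt (real (card I + 1)))" by simp
  also have "\<dots> \<le> real u ^ (card I - 1) * (2 ^ card I / sqrt (real (card I + 1)))"
    using card_PiE_sum_mod_le[OF I, of u "s mod u"]
    by (intro mult_right_mono) (auto simp flip: of_nat_power)
  finally show ?thesis .
qed

lemma card_layer_Suc_pattern_le:
  assumes I: "finite I" and J: "J \<subseteq> I"
  shows "card {x \<in> layer I (Suc m) s. {i \<in> I. x i < m} = J}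
      \<le> card (layer J m (s - m * card (I - J)))"
proof -
  let ?Y = "{x \<in> layer I (Suc m) s. {i \<in> I. x i < m} = J}"
  have off: "x i = m" if "x \<in> ?Y" "i \<in> I - J" for x i
    using that by (auto simp: layer_def PiE_iff less_Suc_eq)
  have "inj_on (\<lambda>x. restrict x J) ?Y"
  proof (rule inj_onI)
    fix x y assume x: "x \<in> ?Y" and y: "y \<in> ?Y" and eq: "restrict x J = restrict y J"
    have "x i = y i" if "i \<in> I" for i
      using fun_cong[OF eq, of i] off[OF x, of i] off[OF y, of i] that by (cases "i \<in> J") auto
    then show "x = y" using x y by (auto simp: layer_def intro!: PiE_ext[of x I "\<lambda>_. {..<Suc m}" y])
  qed
  moreover have "(\<lambda>x. restrict x J) ` ?Y \<subseteq> layer J m (s - m * card (I - J))"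
  proof (rule image_subsetI)
    fix x assume x: "x \<in> ?Y"
    have "s = sum x (I - J) + sum x J"
      using x sum.subset_diff[OF J I, of x] by (simp add: layer_def)
    also have "sum x (I - J) = m * card (I - J)" using off[OF x] by simp
    finally have "sum x J = s - m * card (I - J)" by simp
    then show "restrict x J \<in> layer J m (s - m * card (I - J))" using x by (auto simp: layer_def)
  qed
  ultimately show ?thesis
    using J I by (intro card_inj_on_le finite_layer) (auto intro: finite_subset)
qed

lemma card_layer_Suc_le:
  assumes I: "finite I"
  shows "card (layer I (Suc m) s) \<le> (\<Sum>J\<in>Pow I. card (layer J m (s - m * card (I - J))))"
proof -
  let ?Y = "\<lambda>J. {x \<in> layer I (Suc m) s. {i \<in> I. x i < m} = J}"
  have "layer I (Suc m) s \<subseteq> (\<Union>J\<in>Pow I. ?Y J)"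
  proof
    fix x assume "x \<in> layer I (Suc m) s"
    then show "x \<in> (\<Union>J\<in>Pow I. ?Y J)" by (intro UN_I[of "{i \<in> I. x i < m}"]) auto
  qed
  then have "card (layer I (Suc m) s) \<le> card (\<Union>J\<in>Pow I. ?Y J)"
    using I by (intro card_mono) (simp_all add: finite_layer)
  also have "\<dots> \<le> (\<Sum>J\<in>Pow I. card (?Y J))" using I by (intro card_UN_le) simp
  also have "\<dots> \<le> (\<Sum>J\<in>Pow I. card (layer J m (s - m * card (I - J))))"
    using I by (intro sum_mono card_layer_Suc_pattern_le) simp_all
  finally show ?thesis .
qed

lemma sum_even_layer_bounds_le:
  fixes u :: real
  assumes u: "0 < u"
  shows "(\<Sum>m\<le>N. real (N choose m) * (u ^ (m - 1) * (2 ^ m / sqrt (real (m + 1)))))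
    \<le> 1 + (1 + 2 * u) ^ N * sqrt ((1 + 2 * u) / (2 * u)) / (u * sqrt (real (N + 1)))"
proof -
  define a where "a m = real (N choose m) * (2 * u) ^ m / sqrt (real (m + 1))" for m
  have "real (N choose m) * (u ^ (m - 1) * (2 ^ m / sqrt (real (m + 1))))
      \<le> (if m = 0 then 1 else 0) + a m / u" for m
    using u by (cases m) (auto simp: a_def power_mult_distrib mult_ac)
  then have "(\<Sum>m\<le>N. real (N choose m) * (u ^ (m - 1) * (2 ^ m / sqrt (real (m + 1)))))
      \<le> (\<Sum>m\<le>N. (if m = 0 then 1 else 0) + a m / u)"
    by (intro sum_mono)
  also have "\<dots> = 1 + (\<Sum>m\<le>N. a m) / u" by (simp add: sum.distrib sum_divide_distrib)
  also have "\<dots> \<le> 1 + ((1 + 2 * u) ^ N * sqrt ((1 + 2 * u) / (2 * u)) / sqrt (real (N + 1))) / u"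
    unfolding a_def using u by (intro add_left_mono divide_right_mono sum_binomial_div_sqrt_le) auto
  finally show ?thesis by (simp add: mult.commute)
qed

lemma sqrt_le_power_pred:
  fixes t :: real
  assumes t: "2 \<le> t" and N: "0 < N"
  shows "sqrt (real N) \<le> t ^ (N - 1)"
proof -
  have "N \<le> 2 ^ (N - 1)" using N less_exp[of "N - 1"] by linarith
  then have "real N \<le> 2 ^ (N - 1)" by (metis of_nat_le_iff of_nat_numeral of_nat_power)
  moreover have "sqrt (real N) \<le> real N"
    using N by (intro real_le_lsqrt) (auto simp: power2_eq_square)
  moreover have "(2::real) ^ (N - 1) \<le> t ^ (N - 1)" using t by (intro power_mono) auto
  ultimately show ?thesis by linarith
qed

lemma card_layer_odd_le:
  assumes I: "finite I" "I \<noteq> {}" and u: "0 < u"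
  shows "real (card (layer I (2 * u + 1) s))
      \<le> 5 * real (2 * u + 1) ^ (card I - 1) / sqrt (real (card I))"
proof -
  define N where "N = card I"
  define t where "t = 1 + 2 * real u"
  have N: "0 < N" using I by (simp add: N_def card_gt_0_iff)
  have t: "2 \<le> t" using u by (simp add: t_def)
  have "real (card (layer I (Suc (2 * u)) s))
      \<le> (\<Sum>J\<in>Pow I. real (card (layer J (2 * u) (s - 2 * u * card (I - J)))))"
    using card_layer_Suc_le[OF I(1), of "2 * u" s] by (simp flip: of_nat_sum)
  also have "\<dots> \<le> (\<Sum>J\<in>Pow I. real u ^ (card J - 1) * (2 ^ card J / sqrt (real (card J + 1))))"
    using I(1) u by (intro sum_mono card_layer_even_le) (auto intro: finite_subset)
  also have "\<dots> = (\<Sum>m\<le>N. real (N choose m) * (real u ^ (m - 1) * (2 ^ m / sqrt (real (m + 1)))))"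
    unfolding N_def by (rule sum_Pow_card[OF I(1)])
  also have "\<dots> \<le> 1 + t ^ N * sqrt (t / (2 * real u)) / (real u * sqrt (real (N + 1)))"
    unfolding t_def using u by (intro sum_even_layer_bounds_le) simp
  also have "\<dots> = 1 + (t / real u * sqrt (t / (2 * real u))) * (t ^ (N - 1) / sqrt (real (N + 1)))"
    using N by (cases N) auto
  also have "\<dots> \<le> 1 + (3 * (4 / 3)) * (t ^ (N - 1) / sqrt (real N))"
  proof -
    have "t / real u \<le> 3" "t / (2 * real u) \<le> 3 / 2" using u by (auto simp: t_def field_simps)
    moreover from this have "sqrt (t / (2 * real u)) \<le> 4 / 3"
      by (intro real_le_lsqrt) (auto simp: power2_eq_square)
    ultimately show ?thesis
      using t N by (intro add_left_mono mult_mono divide_left_mono) auto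
  qed
  also have "\<dots> \<le> 5 * (t ^ (N - 1) / sqrt (real N))"
  proof -
    have "1 \<le> t ^ (N - 1) / sqrt (real N)" using sqrt_le_power_pred[OF t N] N by simp
    then show ?thesis by simp
  qed
  finally show ?thesis by (simp add: t_def N_def add.commute)
qed

lemma card_layer_le:
  assumes I: "finite I" "I \<noteq> {}" and t: "2 \<le> t"
  shows "real (card (layer I t s)) \<le> 5 * real t ^ (card I - 1) / sqrt (real (card I))"
proof -
  define u where "u = t div 2"
  have u: "0 < u" using t by (simp add: u_def)
  consider (even) "t = 2 * u" | (odd) "t = 2 * u + 1" unfolding u_def by linarith
  then show ?thesis
  proof cases
    case even
    obtain N where N: "card I = Suc N" using I by (metis card_eq_0_iff not0_implies_Suc)
    have "real (card (layer I t s)) \<le> real u ^ N * 2 ^ Suc N / sqrt (real (Suc N + 1))"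
      using card_layer_even_le[OF I(1) u, of s] by (simp add: even N)
    also have "\<dots> \<le> real u ^ N * 2 ^ Suc N / sqrt (real (Suc N))"
      by (intro divide_left_mono) auto
    also have "\<dots> \<le> 5 * real t ^ N / sqrt (real (Suc N))"
      by (intro divide_right_mono) (auto simp: even power_mult_distrib)
    finally show ?thesis by (simp add: N)
  next
    case odd
    then show ?thesis using card_layer_odd_le[OF I u] by simp
  qed
qed

section \<open>A lower bound for the width\<close>

lemma hypergrid_less: "x \<in> hypergrid t n \<Longrightarrow> i < n \<Longrightarrow> x i < t"
  by (auto simp: hypergrid_def PiE_iff)

lemma hypergrid_eqI:
  assumes "x \<in> hypergrid t n" "y \<in> hypergrid t n" "\<And>i. i < n \<Longrightarrow> x i = y i"
  shows "x = y"
  using assms by (auto simp: hypergrid_def intro!: PiE_ext[of x "{..<n}" "\<lambda>_. {..<t}" y])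

lemma card_hypergrid: "card (hypergrid t n) = t ^ n"
  by (simp add: hypergrid_def card_PiE)

lemma layer_in_grid_antichains: "layer {..<n} t s \<in> grid_antichains t n"
proof -
  have "x = y"
    if x: "x \<in> layer {..<n} t s" and y: "y \<in> layer {..<n} t s" and le: "grid_le n x y" for x y
  proof (rule hypergrid_eqI)
    show "x \<in> hypergrid t n" "y \<in> hypergrid t n" using x y by (auto simp: layer_def hypergrid_def)
    have "\<not> (\<exists>i\<in>{..<n}. x i < y i)"
      using sum_strict_mono_ex1[of "{..<n}" x y] x y le by (auto simp: layer_def grid_le_def)
    then show "x i = y i" if "i < n" for i using that le by (auto simp: grid_le_def le_less)
  qed
  then show ?thesis by (auto simp: grid_antichains_def layer_def hypergrid_def)
qed

lemma sum_hypergrid_Suc: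
  fixes f :: "(nat \<Rightarrow> nat) \<Rightarrow> 'b::comm_monoid_add"
  shows "(\<Sum>x\<in>hypergrid t (Suc n). f x) = (\<Sum>x\<in>hypergrid t n. \<Sum>v<t. f (x(n := v)))"
proof -
  have "(\<Sum>x\<in>hypergrid t (Suc n). f x) = (\<Sum>(v, x)\<in>{..<t} \<times> hypergrid t n. f (x(n := v)))"
    unfolding hypergrid_def lessThan_Suc PiE_insert_eq
    by (subst sum.reindex[OF inj_combinator]) (auto simp: case_prod_beta)
  also have "\<dots> = (\<Sum>x\<in>hypergrid t n. \<Sum>v<t. f (x(n := v)))"
    unfolding sum.cartesian_product[symmetric] by (rule sum.swap)
  finally show ?thesis .
qed

definition centred_rank :: "nat \<Rightarrow> nat \<Rightarrow> (nat \<Rightarrow> nat) \<Rightarrow> real" where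
  "centred_rank t n x = 2 * real (\<Sum>i<n. x i) - real n * (real t - 1)"

lemma sum_centred_rank_squared_le:
  "(\<Sum>x\<in>hypergrid t n. (centred_rank t n x)\<^sup>2) \<le> real n * real t ^ (n + 2)"
proof (induction n)
  case (Suc n)
  define a where "a v = 2 * real v - (real t - 1)" for v
  have mean: "(\<Sum>v<t. a v) = 0"
  proof -
    have "(\<Sum>v<t. 2 * real v) = real t * (real t - 1)" by (induction t) (auto simp: algebra_simps)
    then show ?thesis by (simp add: a_def sum_subtractf)
  qed
  have second_moment: "(\<Sum>v<t. (a v)\<^sup>2) \<le> (\<Sum>v<t. (real t)\<^sup>2)"
  proof (rule sum_mono)
    fix v assume "v \<in> {..<t}"
    then have "\<bar>a v\<bar> \<le> \<bar>real t\<bar>" by (auto simp: a_def abs_le_iff)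
    then show "(a v)\<^sup>2 \<le> (real t)\<^sup>2" by (simp only: abs_le_square_iff)
  qed
  have "(\<Sum>x\<in>hypergrid t (Suc n). (centred_rank t (Suc n) x)\<^sup>2)
      = (\<Sum>x\<in>hypergrid t n. \<Sum>v<t. (centred_rank t n x + a v)\<^sup>2)"
    unfolding sum_hypergrid_Suc
    by (intro sum.cong) (auto simp: centred_rank_def a_def algebra_simps)
  also have "\<dots> = (\<Sum>x\<in>hypergrid t n. real t * (centred_rank t n x)\<^sup>2
      + 2 * centred_rank t n x * (\<Sum>v<t. a v) + (\<Sum>v<t. (a v)\<^sup>2))"
    by (intro sum.cong)
      (auto simp: power2_sum sum.distrib sum_distrib_left sum_distrib_right mult_ac)
  also have "\<dots> = real t * (\<Sum>x\<in>hypergrid t n. (centred_rank t n x)\<^sup>2) + real t ^ n * (\<Sum>v<t. (a v)\<^sup>2)"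
    by (simp add: mean sum.distrib sum_distrib_left card_hypergrid)
  also have "\<dots> \<le> real t * (real n * real t ^ (n + 2)) + real t ^ n * (\<Sum>v<t. (real t)\<^sup>2)"
    using Suc second_moment by (intro add_mono mult_left_mono) auto
  also have "\<dots> = real (Suc n) * real t ^ (Suc n + 2)" by (simp add: algebra_simps power2_eq_square)
  finally show ?case .
qed (simp add: centred_rank_def)

lemma card_abs_greater_mult_le_sum_squares:
  fixes f :: "'a \<Rightarrow> real"
  assumes "finite A" "0 \<le> L"
  shows "real (card {x \<in> A. L < \<bar>f x\<bar>}) * L\<^sup>2 \<le> (\<Sum>x\<in>A. (f x)\<^sup>2)"
proof -
  have "real (card {x \<in> A. L < \<bar>f x\<bar>}) * L\<^sup>2 = (\<Sum>x\<in>{x \<in> A. L < \<bar>f x\<bar>}. L\<^sup>2)" by simp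
  also have "\<dots> \<le> (\<Sum>x\<in>{x \<in> A. L < \<bar>f x\<bar>}. (f x)\<^sup>2)"
    using assms(2) by (intro sum_mono) (auto simp flip: abs_le_square_iff)
  also have "\<dots> \<le> (\<Sum>x\<in>A. (f x)\<^sup>2)" using assms(1) by (intro sum_mono2) auto
  finally show ?thesis .
qed

lemma card_hypergrid_central_ge:
  assumes n: "1 \<le> n" and t: "1 \<le> t"
  shows "real t ^ n / 2
      \<le> real (card {x \<in> hypergrid t n. \<bar>centred_rank t n x\<bar> \<le> real t * sqrt (2 * real n)})"
proof -
  define L where "L = real t * sqrt (2 * real n)"
  define far where "far = {x \<in> hypergrid t n. L < \<bar>centred_rank t n x\<bar>}"
  have L: "0 < L" "L\<^sup>2 = 2 * real n * (real t)\<^sup>2" using n t by (auto simp: L_def power_mult_distrib)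
  have "real (card far) * L\<^sup>2 \<le> (\<Sum>x\<in>hypergrid t n. (centred_rank t n x)\<^sup>2)"
    unfolding far_def using L(1) finite_hypergrid
    by (intro card_abs_greater_mult_le_sum_squares) auto
  also have "\<dots> \<le> real n * real t ^ (n + 2)" by (rule sum_centred_rank_squared_le)
  also have "\<dots> = (real t ^ n / 2) * L\<^sup>2"
    unfolding L(2) by (simp add: power_add power2_eq_square)
  finally have far: "real (card far) \<le> real t ^ n / 2"
    using L(1) by (subst (asm) mult_le_cancel_right) auto
  have "{x \<in> hypergrid t n. \<bar>centred_rank t n x\<bar> \<le> L} = hypergrid t n - far" by (auto simp: far_def)
  then have "real (card {x \<in> hypergrid t n. \<bar>centred_rank t n x\<bar> \<le> L})
      = real t ^ n - real (card far)"
    using finite_hypergrid[of t n] card_mono[OF finite_hypergrid, of far t n]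
    by (simp add: far_def card_Diff_subset card_hypergrid of_nat_diff)
  then show ?thesis using far by (simp add: L_def)
qed

lemma card_nat_interval_le:
  fixes a b :: real
  assumes "a \<le> b"
  shows "finite {s::nat. a \<le> real s \<and> real s \<le> b}"
    and "real (card {s::nat. a \<le> real s \<and> real s \<le> b}) \<le> b - a + 1"
proof -
  let ?S = "{s::nat. a \<le> real s \<and> real s \<le> b}"
  have sub: "int ` ?S \<subseteq> {\<lceil>a\<rceil>..\<lfloor>b\<rfloor>}" by (auto simp: ceiling_le_iff le_floor_iff)
  then have "finite (int ` ?S)" by (rule finite_subset) simp
  then show "finite ?S" by (rule finite_imageD) simp
  have "card ?S \<le> nat (\<lfloor>b\<rfloor> - \<lceil>a\<rceil> + 1)"
    using card_mono[OF _ sub] by (simp add: card_image)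
  then show "real (card ?S) \<le> b - a + 1" using assms by linarith
qed

lemma power_le_grid_width:
  assumes n: "1 \<le> n" and t: "1 \<le> t"
  shows "real t ^ (n - 1) \<le> 8 * sqrt (real n) * real (grid_width t n)"
proof -
  define L where "L = real t * sqrt (2 * real n)"
  define mid where "mid = real n * (real t - 1) / 2"
  define S where "S = {s::nat. mid - L / 2 \<le> real s \<and> real s \<le> mid + L / 2}"
  have "1 * 1 \<le> L" unfolding L_def using n t by (intro mult_mono) auto
  moreover have "L \<le> real t * (2 * sqrt (real n))"
  proof -
    have "sqrt 2 \<le> (2::real)" by (rule real_le_lsqrt) auto
    then show ?thesis unfolding L_def real_sqrt_mult by (intro mult_left_mono mult_right_mono) auto
  qed
  ultimately have S: "finite S" "real (card S) \<le> 4 * real t * sqrt (real n)"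
    using card_nat_interval_le[of "mid - L / 2" "mid + L / 2"] by (auto simp: S_def)
  have "{x \<in> hypergrid t n. \<bar>centred_rank t n x\<bar> \<le> L} \<subseteq> (\<Union>s\<in>S. layer {..<n} t s)"
    by (auto simp: S_def layer_def hypergrid_def centred_rank_def mid_def abs_le_iff field_simps
      simp del: of_nat_sum)
  then have "card {x \<in> hypergrid t n. \<bar>centred_rank t n x\<bar> \<le> L} \<le> card (\<Union>s\<in>S. layer {..<n} t s)"
    using S(1) finite_layer by (intro card_mono) auto
  also have "\<dots> \<le> (\<Sum>s\<in>S. card (layer {..<n} t s))" by (rule card_UN_le[OF S(1)])
  also have "\<dots> \<le> (\<Sum>s\<in>S. grid_width t n)"
    by (intro sum_mono card_le_grid_width layer_in_grid_antichains)
  finally have "real (card {x \<in> hypergrid t n. \<bar>centred_rank t n x\<bar> \<le> L})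
      \<le> real (card S) * real (grid_width t n)"
    by (simp flip: of_nat_mult)
  then have "real t ^ n / 2 \<le> real (card S) * real (grid_width t n)"
    using card_hypergrid_central_ge[OF n t] unfolding L_def by linarith
  also have "\<dots> \<le> (4 * real t * sqrt (real n)) * real (grid_width t n)"
    using S(2) by (intro mult_right_mono) auto
  finally have "real t * real t ^ (n - 1) \<le> real t * (8 * sqrt (real n) * real (grid_width t n))"
    using n by (cases n) (auto simp: algebra_simps)
  then show ?thesis using t by simp
qed

section \<open>Comparable points in the hypergrid\<close>

definition grid_comparable :: "nat \<Rightarrow> (nat \<Rightarrow> nat) \<Rightarrow> (nat \<Rightarrow> nat) \<Rightarrow> bool" where
  "grid_comparable n x y \<longleftrightarrow> grid_le n x y \<or> grid_le n y x"

lemma grid_antichains_eq_indep_sets: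
  "grid_antichains t n = indep_sets (grid_comparable n) (hypergrid t n)"
  by (auto simp: grid_antichains_def indep_sets_def grid_comparable_def)

lemma finite_subset_hypergrid: "F \<subseteq> hypergrid t n \<Longrightarrow> finite F"
  by (rule finite_subset[OF _ finite_hypergrid])

lemma restrict_eqD: "restrict f A = restrict g A \<Longrightarrow> i \<in> A \<Longrightarrow> f i = g i"
  by (metis restrict_apply')

section \<open>Symmetric chains\<close>

text \<open>
  The usual inductive symmetric chain decomposition, in coordinates: the label identifies the chain
  through \<open>x\<close>, and the sum of its entries is the rank of the lowest point of that chain. A chain of
  length \<open>l\<close> times \<open>[t]\<close> splits into L-shaped chains, and the point at distance \<open>D\<close> from the top
  of the chain and height \<open>v\<close> in \<open>[t]\<close> lies in the one numbered \<open>min v D\<close>.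
\<close>

primrec chain_label :: "nat \<Rightarrow> nat \<Rightarrow> (nat \<Rightarrow> nat) \<Rightarrow> nat list" where
  "chain_label t 0 x = []"
| "chain_label t (Suc n) x =
     min (x n) (n * (t - 1) - sum_list (chain_label t n x) - (\<Sum>i<n. x i)) # chain_label t n x"

lemma chain_label_cong:
  assumes "\<And>i. i < n \<Longrightarrow> x i = y i"
  shows "chain_label t n x = chain_label t n y"
  using assms by (induction n) auto

lemma chain_label_sum_bounds:
  assumes "\<And>i. i < n \<Longrightarrow> x i < t"
  shows "sum_list (chain_label t n x) \<le> (\<Sum>i<n. x i)"
    and "sum_list (chain_label t n x) + (\<Sum>i<n. x i) \<le> n * (t - 1)"
proof -
  have "sum_list (chain_label t n x) \<le> (\<Sum>i<n. x i) \<and>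
        sum_list (chain_label t n x) + (\<Sum>i<n. x i) \<le> n * (t - 1)"
    using assms
  proof (induction n)
    case (Suc n)
    have "x n \<le> t - 1" using Suc.prems[of n] by simp
    then show ?case using Suc.IH Suc.prems by (simp add: less_Suc_eq) linarith
  qed simp
  then show "sum_list (chain_label t n x) \<le> (\<Sum>i<n. x i)"
    and "sum_list (chain_label t n x) + (\<Sum>i<n. x i) \<le> n * (t - 1)" by auto
qed

lemma chain_label_eq_imp_grid_le:
  assumes "\<And>i. i < n \<Longrightarrow> x i < t" "\<And>i. i < n \<Longrightarrow> y i < t"
    and "chain_label t n x = chain_label t n y" and "(\<Sum>i<n. x i) \<le> (\<Sum>i<n. y i)"
  shows "grid_le n x y"
  using assms
proof (induction n)
  case 0
  then show ?case by (simp add: grid_le_def)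
next
  case (Suc n)
  let ?l = "sum_list (chain_label t n x)" and ?X = "\<Sum>i<n. x i" and ?Y = "\<Sum>i<n. y i"
  have label: "chain_label t n x = chain_label t n y"
    and head: "min (x n) (n * (t - 1) - ?l - ?X) = min (y n) (n * (t - 1) - ?l - ?Y)"
    using Suc.prems(3) by auto
  have "?l + ?X \<le> n * (t - 1)" "?l + ?Y \<le> n * (t - 1)"
    using chain_label_sum_bounds(2)[of n x t] chain_label_sum_bounds(2)[of n y t]
      Suc.prems(1,2) label by auto
  moreover have "?X + x n \<le> ?Y + y n" using Suc.prems(4) by simp
  ultimately have "?X \<le> ?Y \<and> x n \<le> y n"
    using head by (cases "?X \<le> ?Y") linarith+
  then show ?case
    using Suc.IH[OF _ _ label] Suc.prems(1,2) by (auto simp: grid_le_def less_Suc_eq)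
qed

lemma chain_label_fun_upd_eq:
  assumes "y \<in> hypergrid t n" "chain_label t n y = chain_label t n x" "v < t"
    and "min v (n * (t - 1) - sum_list (chain_label t n x) - (\<Sum>i<n. y i))
      = min (x n) (n * (t - 1) - sum_list (chain_label t n x) - (\<Sum>i<n. x i))"
  shows "y(n := v) \<in> hypergrid t (Suc n)"
    and "chain_label t (Suc n) (y(n := v)) = chain_label t (Suc n) x"
proof -
  show "y(n := v) \<in> hypergrid t (Suc n)"
    using assms(1,3) by (simp add: hypergrid_def lessThan_Suc PiE_fun_upd)
  have "chain_label t n (y(n := v)) = chain_label t n x"
    using assms(2) chain_label_cong[of n "y(n := v)" y t] by simp
  then show "chain_label t (Suc n) (y(n := v)) = chain_label t (Suc n) x" using assms(4) by simp
qed

lemma chain_label_class_meets_rank: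
  assumes "\<And>i. i < n \<Longrightarrow> x i < t"
    and "sum_list (chain_label t n x) \<le> r" and "sum_list (chain_label t n x) + r \<le> n * (t - 1)"
  shows "\<exists>y\<in>hypergrid t n. chain_label t n y = chain_label t n x \<and> (\<Sum>i<n. y i) = r"
  using assms
proof (induction n arbitrary: r)
  case 0
  then show ?case by (auto simp: hypergrid_def)
next
  case (Suc n)
  let ?l = "sum_list (chain_label t n x)" and ?X = "\<Sum>i<n. x i"
  define s where "s = min (x n) (n * (t - 1) - ?l - ?X)"
  have x: "\<And>i. i < n \<Longrightarrow> x i < t" using Suc.prems(1) by simp
  have "x n < t" by (rule Suc.prems(1)) simp
  then have xn: "x n \<le> t - 1" "0 < t" by simp_all
  note bounds = chain_label_sum_bounds[of n x t, OF x]
  have r: "s + ?l \<le> r" "s + ?l + r \<le> (t - 1) + n * (t - 1)"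
    using Suc.prems(2,3) by (auto simp: s_def)
  have s: "s + ?l + ?X \<le> n * (t - 1)" "s \<le> t - 1"
    using bounds xn by (auto simp: s_def)
  have extend: ?case
    if r': "?l \<le> r'" "?l + r' \<le> n * (t - 1)" and v: "v \<le> t - 1" "r' + v = r"
      and head: "min v (n * (t - 1) - ?l - r') = s" for r' v
  proof -
    obtain y where y: "y \<in> hypergrid t n" "chain_label t n y = chain_label t n x" "(\<Sum>i<n. y i) = r'"
      using Suc.IH[OF x r'] by auto
    have "v < t" using v(1) xn(2) by simp
    moreover have "min v (n * (t - 1) - ?l - (\<Sum>i<n. y i)) = min (x n) (n * (t - 1) - ?l - ?X)"
      using head y(3) by (simp add: s_def)
    moreover have "(\<Sum>i<Suc n. (y(n := v)) i) = r" using y(3) v(2) by simp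
    ultimately show ?case using chain_label_fun_upd_eq[OF y(1,2)] by blast
  qed
  show ?case
  proof (cases "?l + r \<le> n * (t - 1)")
    case True
    then show ?thesis using r s by (intro extend[of "r - s" s]) auto
  next
    case False
    then show ?thesis
      using r s bounds
      by (intro extend[of "n * (t - 1) - ?l - s" "r - (n * (t - 1) - ?l - s)"]) auto
  qed
qed

lemma chain_labels_subset_middle_layer:
  "chain_label t n ` hypergrid t n \<subseteq> chain_label t n ` layer {..<n} t (n * (t - 1) div 2)"
proof (rule image_subsetI)
  fix x assume x: "x \<in> hypergrid t n"
  note less = hypergrid_less[OF x]
  have "sum_list (chain_label t n x) \<le> n * (t - 1) div 2"
    "sum_list (chain_label t n x) + n * (t - 1) div 2 \<le> n * (t - 1)"
    using chain_label_sum_bounds[of n x t, OF less] by auto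
  then obtain y where "y \<in> hypergrid t n" "chain_label t n y = chain_label t n x"
    "(\<Sum>i<n. y i) = n * (t - 1) div 2"
    using chain_label_class_meets_rank[of n x t, OF less] by blast
  then show "chain_label t n x \<in> chain_label t n ` layer {..<n} t (n * (t - 1) div 2)"
    by (intro image_eqI[of _ _ y]) (auto simp: layer_def hypergrid_def)
qed

lemma card_chain_labels_le:
  assumes "1 \<le> n" "2 \<le> t"
  shows "real (card (chain_label t n ` hypergrid t n)) \<le> 5 * real t ^ (n - 1) / sqrt (real n)"
proof -
  have "card (chain_label t n ` hypergrid t n) \<le> card (layer {..<n} t (n * (t - 1) div 2))"
    by (rule surj_card_le[OF _ chain_labels_subset_middle_layer]) (simp add: finite_layer)
  also have "real (card (layer {..<n} t (n * (t - 1) div 2)))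
      \<le> 5 * real t ^ (n - 1) / sqrt (real n)"
    using card_layer_le[of "{..<n}" t "n * (t - 1) div 2"] assms by (simp add: lessThan_empty_iff)
  finally show ?thesis by simp
qed

section \<open>Symmetric chains in a window of coordinates\<close>

definition window_colour :: "nat \<Rightarrow> nat \<Rightarrow> nat \<Rightarrow> nat \<Rightarrow> (nat \<Rightarrow> nat) \<Rightarrow> (nat \<Rightarrow> nat) \<times> nat list" where
  "window_colour t n N a x = (restrict x ({..<n} - {a..<a + N}), chain_label t N (\<lambda>i. x (a + i)))"

lemma window_colour_eq_imp_eq_outside:
  assumes "window_colour t n N a x = window_colour t n N a y" "i < n" "i \<notin> {a..<a + N}"
  shows "x i = y i"
  using restrict_eqD[of x "{..<n} - {a..<a + N}" y i] assms by (auto simp: window_colour_def)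

lemma window_colour_eq_imp_grid_le:
  assumes x: "x \<in> hypergrid t n" and y: "y \<in> hypergrid t n" and a: "a + N \<le> n"
    and eq: "window_colour t n N a x = window_colour t n N a y"
    and rank: "(\<Sum>i<N. x (a + i)) \<le> (\<Sum>i<N. y (a + i))"
  shows "grid_le n x y"
proof -
  have "grid_le N (\<lambda>i. x (a + i)) (\<lambda>i. y (a + i))"
    using hypergrid_less[OF x] hypergrid_less[OF y] a eq rank
    by (intro chain_label_eq_imp_grid_le[of N _ t]) (auto simp: window_colour_def)
  then have inside: "x i \<le> y i" if "i \<in> {a..<a + N}" for i
    using that by (auto simp: grid_le_def dest!: spec[of _ "i - a"])
  have "x i \<le> y i" if "i < n" for i
    using inside window_colour_eq_imp_eq_outside[OF eq that] by (cases "i \<in> {a..<a + N}") auto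
  then show ?thesis by (simp add: grid_le_def)
qed

lemma window_colour_eq_imp_comparable:
  assumes "x \<in> hypergrid t n" "y \<in> hypergrid t n" "a + N \<le> n"
    and "window_colour t n N a x = window_colour t n N a y"
  shows "grid_comparable n x y"
  using window_colour_eq_imp_grid_le[OF assms(1,2,3,4)]
    window_colour_eq_imp_grid_le[OF assms(2,1,3) assms(4)[symmetric]]
    linear[of "\<Sum>i<N. x (a + i)" "\<Sum>i<N. y (a + i)"]
  unfolding grid_comparable_def by blast

lemma window_colours_eq_imp_eq:
  assumes "x \<in> hypergrid t n" "y \<in> hypergrid t n"
    and "window_colour t n N a x = window_colour t n N a y"
    and "window_colour t n N b x = window_colour t n N b y"
    and "{a..<a + N} \<inter> {b..<b + N} = {}"
  shows "x = y"
  using assms(1,2)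
proof (rule hypergrid_eqI)
  fix i assume "i < n"
  then show "x i = y i"
    using window_colour_eq_imp_eq_outside[OF assms(3)]
      window_colour_eq_imp_eq_outside[OF assms(4)] assms(5)
    by blast
qed

lemma card_window_colours_le:
  assumes t: "2 \<le> t" and N: "1 \<le> N" and a: "a + N \<le> n"
  shows "real (card (window_colour t n N a ` hypergrid t n)) \<le> 5 * real t ^ (n - 1) / sqrt (real N)"
proof -
  let ?P = "({..<n} - {a..<a + N}) \<rightarrow>\<^sub>E {..<t}" and ?L = "chain_label t N ` hypergrid t N"
  have "window_colour t n N a x \<in> ?P \<times> ?L" if x: "x \<in> hypergrid t n" for x
  proof -
    have "restrict (\<lambda>i. x (a + i)) {..<N} \<in> hypergrid t N"
      using hypergrid_less[OF x] a by (auto simp: hypergrid_def)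
    moreover have "chain_label t N (\<lambda>i. x (a + i))
        = chain_label t N (restrict (\<lambda>i. x (a + i)) {..<N})"
      by (rule chain_label_cong) simp
    ultimately show ?thesis using hypergrid_less[OF x] by (auto simp: window_colour_def)
  qed
  then have "window_colour t n N a ` hypergrid t n \<subseteq> ?P \<times> ?L" by blast
  then have "card (window_colour t n N a ` hypergrid t n) \<le> card (?P \<times> ?L)"
    by (intro card_mono finite_cartesian_product finite_imageI finite_hypergrid finite_PiE) auto
  also have "\<dots> = t ^ (n - N) * card ?L"
  proof -
    have "{a..<a + N} \<subseteq> {..<n}" using a by auto
    then show ?thesis by (simp add: card_cartesian_product card_PiE card_Diff_subset)
  qed
  finally have "real (card (window_colour t n N a ` hypergrid t n))
      \<le> real t ^ (n - N) * real (card ?L)"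
    by (simp flip: of_nat_power of_nat_mult)
  also have "\<dots> \<le> real t ^ (n - N) * (5 * real t ^ (N - 1) / sqrt (real N))"
    using card_chain_labels_le[OF N t] by (intro mult_left_mono) auto
  also have "\<dots> = 5 * real t ^ (n - N + (N - 1)) / sqrt (real N)" by (simp add: power_add)
  also have "n - N + (N - 1) = n - 1" using N a by simp
  finally show ?thesis .
qed

lemma exists_high_degree_windows:
  assumes t: "2 \<le> t" and N: "1 \<le> N" "M * N \<le> n" and F: "F \<subseteq> hypergrid t n" "F \<noteq> {}"
  shows "\<exists>x\<in>F. real M * (real (card F) / (5 * real t ^ (n - 1) / sqrt (real N)) - 1)
    \<le> real (card (neighbours (grid_comparable n) F x))"
proof -
  define col where "col b = window_colour t n N (b * N)" for b
  have window: "b * N + N \<le> n" if "b < M" for b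
    using mult_le_mono1[of "Suc b" M N] that N(2) by simp
  have disjoint: "{b * N..<b * N + N} \<inter> {c * N..<c * N + N} = {}" if "b \<noteq> c" for b c
  proof -
    have "Suc b * N \<le> c * N \<or> Suc c * N \<le> b * N"
      using that by (metis Suc_leI linorder_neqE_nat mult_le_mono1)
    then show ?thesis by auto
  qed
  show ?thesis
  proof (rule exists_high_degree_of_colourings[where col = col and far = "\<lambda>x y. y \<noteq> x"])
    show "0 < 5 * real t ^ (n - 1) / sqrt (real N)" using t N by simp
    fix b assume b: "b < M"
    have "card (col b ` F) \<le> card (window_colour t n N (b * N) ` hypergrid t n)"
      using F(1) finite_hypergrid unfolding col_def by (intro card_mono image_mono) auto
    then show "real (card (col b ` F)) \<le> 5 * real t ^ (n - 1) / sqrt (real N)"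
      using card_window_colours_le[OF t N(1) window[OF b]] by linarith
    fix x assume x: "x \<in> F"
    have "{y \<in> F. col b y = col b x \<and> \<not> y \<noteq> x} = {x}" using x by auto
    then show "real (card {y \<in> F. col b y = col b x \<and> \<not> y \<noteq> x}) \<le> 1" by simp
    fix y assume y: "y \<in> F" and neq: "y \<noteq> x" and eq: "col b y = col b x"
    have xy: "x \<in> hypergrid t n" "y \<in> hypergrid t n" using x y F(1) by auto
    show "y \<in> neighbours (grid_comparable n) F x"
      using window_colour_eq_imp_comparable[OF xy window[OF b]] y neq eq
      by (simp add: neighbours_def col_def)
    show "b = c" if "col c y = col c x" for c
      using window_colours_eq_imp_eq[OF xy, of N "b * N" "c * N"] disjoint[of b c] that eq neq
      by (auto simp: col_def)
  qed (use finite_subset_hypergrid F in auto)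
qed

section \<open>Staircases in the plane of two coordinates\<close>

text \<open>The level sets are staircases of slope \<open>(m - a) : a\<close>, increasing because of the reflection
  \<open>t - q\<close>; those of different slopes separate quickly.\<close>

definition staircase :: "nat \<Rightarrow> nat \<Rightarrow> nat \<Rightarrow> nat \<Rightarrow> nat \<Rightarrow> nat" where
  "staircase m t a p q = ((m - a) * p + a * (t - q)) div m"

lemma staircase_less:
  assumes "a \<le> m" "0 < m" and "p < p'" "q' < q" "q \<le> t"
  shows "staircase m t a p q < staircase m t a p' q'"
proof -
  obtain d where "m = a + d" using \<open>a \<le> m\<close> le_Suc_ex by blast
  then have "(m - a) * p + a * (t - q) + m = (m - a) * (p + 1) + a * (t - q + 1)" by simp
  also have "\<dots> \<le> (m - a) * p' + a * (t - q')"
    using assms by (intro add_mono mult_left_mono) auto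
  finally have "((m - a) * p + a * (t - q) + m) div m \<le> staircase m t a p' q'"
    unfolding staircase_def by (rule div_le_mono)
  then show ?thesis using \<open>0 < m\<close> by (simp add: staircase_def)
qed

lemma staircase_eq_imp_comparable:
  assumes "a \<le> m" "0 < m" "q \<le> t" "q' \<le> t" and "staircase m t a p q = staircase m t a p' q'"
  shows "p \<le> p' \<and> q \<le> q' \<or> p' \<le> p \<and> q' \<le> q"
  using staircase_less[of a m p p' q' q t] staircase_less[of a m p' p q q' t] assms by force

lemma div_eq_imp_diff_less:
  fixes f g m :: nat
  assumes "0 < m" "f div m = g div m"
  shows "\<bar>int f - int g\<bar> < int m"
proof -
  have "int f - int g = int (f mod m) - int (g mod m)"
    using assms(2) div_mult_mod_eq[of f m] div_mult_mod_eq[of g m]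
    by (metis add_diff_cancel_left of_nat_add)
  moreover have "f mod m < m" "g mod m < m" using assms(1) by auto
  ultimately show ?thesis by linarith
qed

lemma staircases_eq_imp_close:
  assumes "a < c" "c \<le> m" "0 < m" and q: "q \<le> t" "q' \<le> t"
    and "staircase m t a p q = staircase m t a p' q'"
    and "staircase m t c p q = staircase m t c p' q'"
  shows "p + q < p' + q' + 2 * m"
proof (rule ccontr)
  define s where "s = int (p + q) - int (p' + q')"
  assume "\<not> ?thesis"
  then have "2 * int m \<le> s" by (simp add: s_def)
  then have "1 * (2 * int m) \<le> (int c - int a) * s"
    using \<open>a < c\<close> by (intro mult_mono) auto
  moreover have near: "\<bar>int m * (int p - int p') - int b * s\<bar> < int m"
    if "b \<le> m" "staircase m t b p q = staircase m t b p' q'" for b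
  proof -
    have "int ((m - b) * p + b * (t - q)) - int ((m - b) * p' + b * (t - q'))
        = int m * (int p - int p') - int b * s"
      unfolding of_nat_add of_nat_mult of_nat_diff[OF that(1)] of_nat_diff[OF q(1)]
        of_nat_diff[OF q(2)]
      by (simp add: s_def algebra_simps)
    then show ?thesis
      using div_eq_imp_diff_less[OF \<open>0 < m\<close> that(2)[unfolded staircase_def]] by simp
  qed
  have "\<bar>int c * s - int a * s\<bar> < 2 * int m"
    using near[of a] near[of c] assms by linarith
  ultimately show False by (simp add: left_diff_distrib)
qed

definition staircase_colour :: "nat \<Rightarrow> nat \<Rightarrow> nat \<Rightarrow> nat \<Rightarrow> (nat \<Rightarrow> nat) \<Rightarrow> nat \<times> (nat \<Rightarrow> nat)" where
  "staircase_colour m t n a x = (staircase m t a (x 0) (x 1), restrict x {2..<n})"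

lemma staircase_colour_eq_imp_eq_outside:
  assumes "staircase_colour m t n a x = staircase_colour m t n a y" "2 \<le> i" "i < n"
  shows "x i = y i"
  using restrict_eqD[of x "{2..<n}" y i] assms by (auto simp: staircase_colour_def)

lemma staircase_colour_eq_imp_comparable:
  assumes x: "x \<in> hypergrid t n" and y: "y \<in> hypergrid t n" and n: "2 \<le> n" and m: "a \<le> m" "0 < m"
    and eq: "staircase_colour m t n a x = staircase_colour m t n a y"
  shows "grid_comparable n x y"
proof -
  have split: "i = 0 \<or> i = 1 \<or> 2 \<le> i" for i :: nat by auto
  have "x 1 \<le> t" "y 1 \<le> t" using hypergrid_less[OF x, of 1] hypergrid_less[OF y, of 1] n by auto
  then have "x 0 \<le> y 0 \<and> x 1 \<le> y 1 \<or> y 0 \<le> x 0 \<and> y 1 \<le> x 1"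
    using staircase_eq_imp_comparable[OF m] eq by (simp add: staircase_colour_def)
  moreover have "x i \<le> y i" if "x 0 \<le> y 0" "x 1 \<le> y 1" "i < n" for i
    using that staircase_colour_eq_imp_eq_outside[OF eq _ that(3)] split[of i] by auto
  moreover have "y i \<le> x i" if "y 0 \<le> x 0" "y 1 \<le> x 1" "i < n" for i
    using that staircase_colour_eq_imp_eq_outside[OF eq _ that(3)] split[of i] by auto
  ultimately show ?thesis by (auto simp: grid_comparable_def grid_le_def)
qed

lemma card_staircase_colours_le:
  assumes m: "a \<le> m" "0 < m" and n: "2 \<le> n"
  shows "card (staircase_colour m t n a ` hypergrid t n) \<le> (t + 1) * t ^ (n - 2)"
proof -
  have "staircase_colour m t n a x \<in> {..t} \<times> ({2..<n} \<rightarrow>\<^sub>E {..<t})" if x: "x \<in> hypergrid t n" for x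
  proof -
    have "(m - a) * x 0 + a * (t - x 1) \<le> (m - a) * t + a * t"
      using hypergrid_less[OF x, of 0] n by (intro add_mono mult_left_mono) auto
    also have "\<dots> = m * t" using m(1) by (simp flip: add_mult_distrib)
    finally have "staircase m t a (x 0) (x 1) \<le> (m * t) div m"
      unfolding staircase_def by (rule div_le_mono)
    then show ?thesis using m(2) hypergrid_less[OF x] by (auto simp: staircase_colour_def)
  qed
  then have "staircase_colour m t n a ` hypergrid t n \<subseteq> {..t} \<times> ({2..<n} \<rightarrow>\<^sub>E {..<t})" by blast
  then have "card (staircase_colour m t n a ` hypergrid t n) \<le> card ({..t} \<times> ({2..<n} \<rightarrow>\<^sub>E {..<t}))"
    by (intro card_mono finite_cartesian_product finite_PiE) auto
  then show ?thesis by (simp add: card_cartesian_product card_PiE)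
qed

lemma inj_on_staircase_colour_class:
  assumes n: "2 \<le> n" and m: "a \<le> m" "0 < m"
  shows "inj_on (\<lambda>y. y 0 + y 1) {y \<in> hypergrid t n. staircase_colour m t n a y = k}"
proof (rule inj_onI)
  fix y z assume "y \<in> {y \<in> hypergrid t n. staircase_colour m t n a y = k}"
    "z \<in> {y \<in> hypergrid t n. staircase_colour m t n a y = k}"
  then have y: "y \<in> hypergrid t n" and z: "z \<in> hypergrid t n"
    and eq: "staircase_colour m t n a y = staircase_colour m t n a z" by auto
  assume sum: "y 0 + y 1 = z 0 + z 1"
  have "y 1 \<le> t" "z 1 \<le> t" using hypergrid_less[OF y, of 1] hypergrid_less[OF z, of 1] n by auto
  then have "y 0 = z 0" "y 1 = z 1"
    using staircase_eq_imp_comparable[OF m, of "y 1" t "z 1" "y 0" "z 0"] eq sum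
    by (auto simp: staircase_colour_def)
  moreover have "i = 0 \<or> i = 1 \<or> 2 \<le> i" for i :: nat by auto
  ultimately have "y i = z i" if "i < n" for i
    using staircase_colour_eq_imp_eq_outside[OF eq _ that] by metis
  then show "y = z" by (rule hypergrid_eqI[OF y z])
qed

definition far_in_plane :: "nat \<Rightarrow> (nat \<Rightarrow> nat) \<Rightarrow> (nat \<Rightarrow> nat) \<Rightarrow> bool" where
  "far_in_plane m x y \<longleftrightarrow> x 0 + x 1 + 2 * m \<le> y 0 + y 1 \<or> y 0 + y 1 + 2 * m \<le> x 0 + x 1"

lemma staircase_colours_eq_imp_not_far:
  assumes "x \<in> hypergrid t n" "y \<in> hypergrid t n" "2 \<le> n" "a < c" "c \<le> m"
    and "staircase_colour m t n a x = staircase_colour m t n a y"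
    and "staircase_colour m t n c x = staircase_colour m t n c y"
  shows "\<not> far_in_plane m x y"
proof -
  have "x 1 \<le> t" "y 1 \<le> t" "0 < m"
    using hypergrid_less[OF assms(1), of 1] hypergrid_less[OF assms(2), of 1] assms(3-5) by auto
  then show ?thesis
    using staircases_eq_imp_close[of a c m "x 1" t "y 1" "x 0" "y 0"]
      staircases_eq_imp_close[of a c m "y 1" t "x 1" "y 0" "x 0"] assms(4-7)
    by (auto simp: staircase_colour_def far_in_plane_def)
qed

lemma card_near_staircase_colour_class_le:
  assumes F: "F \<subseteq> hypergrid t n" and n: "2 \<le> n" and m: "a \<le> m" "0 < m"
  shows "card {y \<in> F. staircase_colour m t n a y = k \<and> \<not> far_in_plane m x y} \<le> 4 * m"
proof -
  let ?N = "{y \<in> F. staircase_colour m t n a y = k \<and> \<not> far_in_plane m x y}"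
  have "inj_on (\<lambda>y. y 0 + y 1) ?N"
    using F by (intro inj_on_subset[OF inj_on_staircase_colour_class[OF n m, of t k]]) auto
  moreover have "(\<lambda>y. y 0 + y 1) ` ?N \<subseteq> {x 0 + x 1 + 1 - 2 * m..<x 0 + x 1 + 2 * m}"
    by (auto simp: far_in_plane_def)
  ultimately have "card ?N \<le> card {x 0 + x 1 + 1 - 2 * m..<x 0 + x 1 + 2 * m}"
    by (intro card_inj_on_le) auto
  then show ?thesis by simp
qed

lemma exists_high_degree_staircases:
  assumes t: "1 \<le> t" and n: "2 \<le> n" and m: "0 < m" and F: "F \<subseteq> hypergrid t n" "F \<noteq> {}"
  shows "\<exists>x\<in>F. real m * (real (card F) / (real (t + 1) * real t ^ (n - 2)) - 4 * real m)
    \<le> real (card (neighbours (grid_comparable n) F x))"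
proof (rule exists_high_degree_of_colourings
    [where col = "staircase_colour m t n" and far = "far_in_plane m"])
  show "0 < real (t + 1) * real t ^ (n - 2)" using t by simp
  fix a assume "a < m"
  then have a: "a \<le> m" by simp
  have "card (staircase_colour m t n a ` F) \<le> card (staircase_colour m t n a ` hypergrid t n)"
    using F(1) finite_hypergrid by (intro card_mono image_mono) auto
  also have "\<dots> \<le> (t + 1) * t ^ (n - 2)" by (rule card_staircase_colours_le[OF a m n])
  finally show "real (card (staircase_colour m t n a ` F)) \<le> real (t + 1) * real t ^ (n - 2)"
    unfolding of_nat_power[symmetric] of_nat_mult[symmetric] of_nat_le_iff .
  fix x assume x: "x \<in> F"
  show "real (card {y \<in> F. staircase_colour m t n a y = staircase_colour m t n a x
      \<and> \<not> far_in_plane m x y}) \<le> 4 * real m"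
    using card_near_staircase_colour_class_le[OF F(1) n a m, of "staircase_colour m t n a x" x]
    by simp
  fix y assume y: "y \<in> F" and far: "far_in_plane m x y"
    and eq: "staircase_colour m t n a y = staircase_colour m t n a x"
  have xy: "x \<in> hypergrid t n" "y \<in> hypergrid t n" using x y F(1) by auto
  show "y \<in> neighbours (grid_comparable n) F x"
    using staircase_colour_eq_imp_comparable[OF xy n a m eq[symmetric]] y far m
    by (auto simp: neighbours_def far_in_plane_def)
  show "a = c" if "c < m" "staircase_colour m t n c y = staircase_colour m t n c x" for c
    using staircase_colours_eq_imp_not_far[OF xy n, of a c m]
      staircase_colours_eq_imp_not_far[OF xy n, of c a m] a that eq far
    by (metis linorder_neqE_nat order_less_imp_le)
qed (use finite_subset_hypergrid F in auto)

section \<open>Supersaturation and the number of small antichains\<close>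

lemma grid_width_pos:
  assumes "1 \<le> n" "1 \<le> t"
  shows "0 < grid_width t n"
proof (rule ccontr)
  assume "\<not> ?thesis"
  then have "real t ^ (n - 1) \<le> 0" using power_le_grid_width[OF assms] by simp
  moreover have "0 < real t ^ (n - 1)" using assms by simp
  ultimately show False by linarith
qed

lemma exists_high_degree_many_coordinates:
  assumes t: "2 \<le> t" and m: "0 < m" "m \<le> n" and F: "F \<subseteq> hypergrid t n" "F \<noteq> {}"
  shows "\<exists>x\<in>F. real m * (real (card F) / (60 * sqrt (real m) * real (grid_width t n)) - 1)
    \<le> real (card (neighbours (grid_comparable n) F x))"
proof -
  define N where "N = n div m"
  define w where "w = real (grid_width t n)"
  have N: "1 \<le> N" "m * N \<le> n"
    using m by (auto simp: N_def Suc_le_eq div_greater_zero_iff)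
  have "n \<le> m * (N + 1)" using m(1) dividend_less_times_div[of m n] by (simp add: N_def)
  also have "\<dots> \<le> m * (2 * N)" using N by (intro mult_left_mono) auto
  finally have "real n \<le> real (m * (2 * N))" by (simp only: of_nat_le_iff)
  also have "\<dots> \<le> (3 / 2)\<^sup>2 * real m * real N" by (simp add: power2_eq_square mult_ac)
  finally have "sqrt (real n) \<le> sqrt ((3 / 2)\<^sup>2 * real m * real N)" by simp
  then have sqrt_n: "sqrt (real n) \<le> 3 / 2 * sqrt (real m) * sqrt (real N)"
    by (simp add: real_sqrt_mult)
  have "5 * real t ^ (n - 1) \<le> 40 * sqrt (real n) * w"
    using power_le_grid_width[of n t] m t by (simp add: w_def)
  also have "\<dots> \<le> 40 * (3 / 2 * sqrt (real m) * sqrt (real N)) * w"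
    using sqrt_n by (intro mult_right_mono mult_left_mono) (auto simp: w_def)
  finally have colours: "5 * real t ^ (n - 1) / sqrt (real N) \<le> 60 * sqrt (real m) * w"
    using N by (simp add: field_simps)
  obtain x where x: "x \<in> F" "real m * (real (card F) / (5 * real t ^ (n - 1) / sqrt (real N)) - 1)
      \<le> real (card (neighbours (grid_comparable n) F x))"
    using exists_high_degree_windows[OF t N F] by blast
  have "0 < 5 * real t ^ (n - 1) / sqrt (real N)" using t N by simp
  then have "real (card F) / (60 * sqrt (real m) * w)
      \<le> real (card F) / (5 * real t ^ (n - 1) / sqrt (real N))"
    using colours by (intro frac_le) auto
  then have "real m * (real (card F) / (60 * sqrt (real m) * w) - 1)
      \<le> real m * (real (card F) / (5 * real t ^ (n - 1) / sqrt (real N)) - 1)"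
    by (intro mult_left_mono) auto
  then show ?thesis using x unfolding w_def by (meson order_trans)
qed

lemma exists_high_degree_few_coordinates:
  assumes t: "2 \<le> t" and n: "2 \<le> n" and m: "0 < m" and F: "F \<subseteq> hypergrid t n" "F \<noteq> {}"
  shows "\<exists>x\<in>F. real m * (real (card F) / (16 * sqrt (real n) * real (grid_width t n)) - 4 * real m)
    \<le> real (card (neighbours (grid_comparable n) F x))"
proof -
  define X where "X = real (t + 1) * real t ^ (n - 2)"
  have "X \<le> 2 * real t * real t ^ (n - 2)" unfolding X_def using t by (intro mult_right_mono) auto
  also have "\<dots> = 2 * real t ^ Suc (n - 2)" by simp
  also have "Suc (n - 2) = n - 1" using n by simp
  also have "2 * real t ^ (n - 1) \<le> 16 * sqrt (real n) * real (grid_width t n)"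
    using power_le_grid_width[of n t] n t by simp
  finally have colours: "X \<le> 16 * sqrt (real n) * real (grid_width t n)" .
  obtain x where x: "x \<in> F" "real m * (real (card F) / X - 4 * real m)
      \<le> real (card (neighbours (grid_comparable n) F x))"
    using exists_high_degree_staircases[OF _ n m F] t unfolding X_def by auto
  have "0 < X" using t by (simp add: X_def)
  then have "real (card F) / (16 * sqrt (real n) * real (grid_width t n)) \<le> real (card F) / X"
    using colours by (intro frac_le) auto
  then have "real m * (real (card F) / (16 * sqrt (real n) * real (grid_width t n)) - 4 * real m)
      \<le> real m * (real (card F) / X - 4 * real m)"
    by (intro mult_left_mono) auto
  then show ?thesis using x by (meson order_trans)
qed

lemma power5_le_degree_bound:
  fixes r w N M q a b :: real
  assumes r: "512 \<le> r" and w: "0 < w" and large: "r ^ 4 * w \<le> N" and M: "r\<^sup>2 / 2 \<le> M"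
    and a: "0 < a" "a \<le> 60" and b: "0 < b" "b \<le> r" and q: "q \<le> 4 * r\<^sup>2"
  shows "r ^ 5 / 240 \<le> M * (N / (a * b * w) - q)"
proof -
  have "r ^ 3 / 60 = r ^ 4 * w / (60 * r * w)" using r w by (simp add: power_def numeral_eq_Suc)
  also have "\<dots> \<le> N / (a * b * w)"
    using a b r w large by (intro frac_le mult_mono mult_pos_pos order_trans[OF _ large]) auto
  finally have "r ^ 3 / 60 \<le> N / (a * b * w)" .
  moreover have "512 * r\<^sup>2 \<le> r ^ 3"
    using mult_right_mono[OF r, of "r\<^sup>2"] by (simp add: power3_eq_cube power2_eq_square)
  ultimately have "r ^ 3 / 120 \<le> N / (a * b * w) - q"
    using q zero_le_power2[of r] by linarith
  then have "(r\<^sup>2 / 2) * (r ^ 3 / 120) \<le> M * (N / (a * b * w) - q)"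
    using r by (intro mult_mono M order_trans[OF _ M]) auto
  then show ?thesis by (simp flip: power_add)
qed

lemma exists_high_degree:
  fixes r :: real
  assumes t: "2 \<le> t" and n: "2 \<le> n" and F: "F \<subseteq> hypergrid t n"
    and r: "512 \<le> r" and large: "r ^ 4 * real (grid_width t n) \<le> real (card F)"
  shows "\<exists>x\<in>F. r ^ 5 / 240 \<le> real (card (neighbours (grid_comparable n) F x))"
proof -
  define w where "w = real (grid_width t n)"
  define m where "m = nat \<lfloor>r\<^sup>2\<rfloor>"
  have w: "0 < w" using grid_width_pos[of n t] n t by (simp add: w_def)
  have "0 < r ^ 4 * w" using r w by simp
  then have nonempty: "F \<noteq> {}" using large by (auto simp: w_def)
  have "512\<^sup>2 \<le> r\<^sup>2" using r by (intro power_mono) auto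
  then have m: "0 < m" "real m \<le> r\<^sup>2" "r\<^sup>2 / 2 \<le> real m"
    unfolding m_def power2_eq_square by linarith+
  note degree_ge = power5_le_degree_bound[OF r w large[folded w_def] m(3)]
  show ?thesis
  proof (cases "m \<le> n")
    case True
    have "r ^ 5 / 240 \<le> real m * (real (card F) / (60 * sqrt (real m) * w) - 1)"
      using m r \<open>512\<^sup>2 \<le> r\<^sup>2\<close> by (intro degree_ge real_le_lsqrt) auto
    then show ?thesis
      using exists_high_degree_many_coordinates[OF t m(1) True F nonempty] unfolding w_def
      by (meson order_trans)
  next
    case False
    then have "real n \<le> r\<^sup>2" using m(2) by linarith
    then have "r ^ 5 / 240 \<le> real m * (real (card F) / (16 * sqrt (real n) * w) - 4 * real m)"
      using m r n by (intro degree_ge real_le_lsqrt) auto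
    then show ?thesis
      using exists_high_degree_few_coordinates[OF t n m(1) F nonempty] unfolding w_def
      by (meson order_trans)
  qed
qed

lemma supersaturated_hypergrid:
  assumes n: "2 \<le> n" and t: "2 \<le> t"
  shows "supersaturated_graph (grid_comparable n) (hypergrid t n) (grid_width t n)
    (1 / 240) (2 ^ 36) 8"
proof
  show "0 < grid_width t n" using grid_width_pos n t by simp
  fix F and K :: real
  assume F: "F \<subseteq> hypergrid t n" and K: "2 ^ 36 \<le> K"
    and large: "K * real (grid_width t n) \<le> real (card F)"
  define r where "r = K powr (1 / 4)"
  have r4: "r ^ 4 = K" using K by (simp add: r_def powr_power)
  have "512 ^ 4 \<le> r ^ 4" using K by (simp add: r4)
  then have r: "512 \<le> r" by (subst (asm) power_mono_iff) (simp_all add: r_def)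
  have "K powr (1 + 2 / real 8) = r ^ 5" using K by (simp add: r_def powr_power)
  then show "\<exists>x\<in>F. 1 / 240 * K powr (1 + 2 / real 8)
      \<le> real (card (neighbours (grid_comparable n) F x))"
    using exists_high_degree[OF t n F r] large r4 by simp
qed (simp_all add: finite_hypergrid)

theorem theorem2p2:
  shows "\<exists>C::real. C > 0 \<and>
    (\<forall>(n::nat) (t::nat) (k::nat). n \<ge> 2 \<longrightarrow> t \<ge> 2 \<longrightarrow> k \<ge> 2 \<longrightarrow>
      real (card {A \<in> grid_antichains t n.
                    real (card A) \<le> (1 / real k) * real (grid_width t n)})
        \<le> 2 powr (C * (log 2 (real k) / real k) * real (grid_width t n)))"
proof (intro exI conjI allI impI)
  let ?C = "supersaturated_graph.count_const (1 / 240) (2 ^ 36) 8"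
  show "0 < ?C"
    using supersaturated_graph.count_const_pos[OF supersaturated_hypergrid[of 2 2]] by simp
  fix n t k :: nat
  assume "2 \<le> n" "2 \<le> t" "2 \<le> k"
  then show "real (card {A \<in> grid_antichains t n.
        real (card A) \<le> (1 / real k) * real (grid_width t n)})
      \<le> 2 powr (?C * (log 2 (real k) / real k) * real (grid_width t n))"
    using supersaturated_graph.card_small_indep_sets_le[OF supersaturated_hypergrid]
    by (simp add: grid_antichains_eq_indep_sets)
qed

end
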